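(* Let $\{\mathcal H,\Gamma\}$ be a B-generalized boundary pair for $A^*$ with Weyl family $M(\cdot)$. Let $\mathcal H_s=\overline{\operatorname{ran}}\operatorname{Im}M(\lambda)$ (this does not depend on $\lambda\in\mathbb C\setminus\mathbb R$). Then there exist an ordinary boundary triple $\{\mathcal H_s,\Gamma^0_0,\Gamma^0_1\}$ for $A^*$ and operators $E=E^*\in\mathcal B(\mathcal H)$ and $G\in\mathcal B(\mathcal H,\mathcal H_s)$ with $\ker G=\mathcal H\ominus\mathcal H_s$ such that $\Gamma=\{\{\hat f,\{h,Eh+G^*\Gamma^0_1\hat f\}\}:\ \hat f\in A^*,\ h\in\mathcal H,\ Gh=\Gamma^0_0\hat f\}$, i.e. $\Gamma_0=G^{-1}\Gamma^0_0$ and $\Gamma_1=EG^{-1}\Gamma^0_0+G^*\Gamma^0_1$ (with $G^{-1}$ the inverse of $G$ as a linear relation). If $M_0(\cdot)$ is the Weyl function of $\{\mathcal H_s,\Gamma^0_0,\Gamma^0_1\}$, then $M(\lambda)=G^*M_0(\lambda)G+E$, $\lambda\in\mathbb C\setminus\mathbb R$.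
   Context: $A$ is a closed symmetric relation in a Hilbert space $\mathfrak H$; $\mathcal H$ a Hilbert space. For a linear relation $\Gamma:\mathfrak H^2\to\mathcal H^2$ put $\Gamma_0=\{\{\hat f,h\}:\{\hat f,\{h,h'\}\}\in\Gamma\}$, $\Gamma_1=\{\{\hat f,h'\}:\{\hat f,\{h,h'\}\}\in\Gamma\}$. A B-generalized boundary pair for $A^*$ is a linear relation $\Gamma$ with $\operatorname{dom}\Gamma\subset A^*$ dense in $A^*$, satisfying Green's identity $(f',g)-(f,g')=(h',k)-(h,k')$ for all $\{\{f,f'\},\{h,h'\}\},\{\{g,g'\},\{k,k'\}\}\in\Gamma$, with $\operatorname{ran}\Gamma_0=\mathcal H$ and $\ker\Gamma_0$ selfadjoint; its Weyl family $M(\lambda)=\{\hat h:\{\{f,\lambda f\},\hat h\}\in\Gamma\}$ is then a bounded operator function. An ordinary boundary triple $\{\mathcal K,\Gamma_0,\Gamma_1\}$ for $A^*$ consists of linear maps $\Gamma_0,\Gamma_1:A^*\to\mathcal K$ satisfying Green's identity with $(\Gamma_0,\Gamma_1):A^*\to\mathcal K^2$ surjective; its Weyl function is defined by $M_0(\lambda)\Gamma_0\hat f=\Gamma_1\hat f$ for $\hat f=\{f,\lambda f\}\in A^*$. *)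

theory Defs
  imports "HOL-Analysis.Analysis"
begin

class scaleC = scaleR +
  fixes scaleC :: "complex \<Rightarrow> 'a \<Rightarrow> 'a" (infixr \<open>*\<^sub>C\<close> 75)
  assumes scaleR_scaleC: "scaleR r = scaleC (complex_of_real r)"

class complex_vector = real_vector + scaleC +
  assumes scaleC_add_right: "a *\<^sub>C (x + y) = a *\<^sub>C x + a *\<^sub>C y"
    and scaleC_add_left: "(a + b) *\<^sub>C x = a *\<^sub>C x + b *\<^sub>C x"
    and scaleC_scaleC: "a *\<^sub>C (b *\<^sub>C x) = (a * b) *\<^sub>C x"
    and scaleC_one: "1 *\<^sub>C x = x"

class complex_inner = complex_vector + real_normed_vector +
  fixes cinner :: "'a \<Rightarrow> 'a \<Rightarrow> complex"
  assumes cinner_commute: "cinner x y = cnj (cinner y x)"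
    and cinner_add_left: "cinner (x + y) z = cinner x z + cinner y z"
    and cinner_scaleC_left: "cinner (r *\<^sub>C x) y = r * cinner x y"
    and cinner_nonneg: "Im (cinner x x) = 0 \<and> 0 \<le> Re (cinner x x)"
    and cinner_eq_zero_iff: "cinner x x = 0 \<longleftrightarrow> x = 0"
    and norm_eq_sqrt_cinner: "norm x = sqrt (Re (cinner x x))"

class chilbert = complex_inner + complete_space

instantiation prod :: (complex_vector, complex_vector) scaleC
begin
definition scaleC_prod_def: "scaleC c x = (scaleC c (fst x), scaleC c (snd x))"
instance by standard (auto simp: fun_eq_iff scaleC_prod_def scaleR_prod_def scaleR_scaleC)
end

instance prod :: (complex_vector, complex_vector) complex_vector
  by standard (auto simp: scaleC_prod_def scaleC_add_right scaleC_add_left scaleC_scaleC scaleC_one)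

definition csubspace :: "'a::complex_vector set \<Rightarrow> bool" where
  "csubspace S \<longleftrightarrow> 0 \<in> S \<and> (\<forall>x\<in>S. \<forall>y\<in>S. x + y \<in> S) \<and> (\<forall>c. \<forall>x\<in>S. c *\<^sub>C x \<in> S)"

definition clinear :: "('a::complex_vector \<Rightarrow> 'b::complex_vector) \<Rightarrow> bool" where
  "clinear T \<longleftrightarrow> (\<forall>x y. T (x + y) = T x + T y) \<and> (\<forall>c x. T (c *\<^sub>C x) = c *\<^sub>C T x)"

definition bounded_clinear :: "('a::complex_inner \<Rightarrow> 'b::complex_inner) \<Rightarrow> bool" where
  "bounded_clinear T \<longleftrightarrow> clinear T \<and> (\<exists>K. \<forall>x. norm (T x) \<le> norm x * K)"

definition cadjoint :: "('a::complex_inner \<Rightarrow> 'b::complex_inner) \<Rightarrow> 'b \<Rightarrow> 'a" where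
  "cadjoint T y = (THE z. \<forall>x. cinner (T x) y = cinner x z)"

definition im_op :: "('a::complex_inner \<Rightarrow> 'a) \<Rightarrow> 'a \<Rightarrow> 'a" where
  "im_op T h = (1 / (2 * \<i>)) *\<^sub>C (T h - cadjoint T h)"

definition orth :: "'a::complex_inner set \<Rightarrow> 'a set" where
  "orth S = {h. \<forall>k\<in>S. cinner h k = 0}"

definition adj_rel :: "('a::complex_inner \<times> 'a) set \<Rightarrow> ('a \<times> 'a) set" where
  "adj_rel T = {(g, g'). \<forall>(f, f')\<in>T. cinner f' g = cinner f g'}"

definition closed_symmetric_rel :: "('a::complex_inner \<times> 'a) set \<Rightarrow> bool" where
  "closed_symmetric_rel A \<longleftrightarrow> csubspace A \<and> closed A \<and> A \<subseteq> adj_rel A"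

definition selfadjoint_rel :: "('a::complex_inner \<times> 'a) set \<Rightarrow> bool" where
  "selfadjoint_rel K \<longleftrightarrow> K = adj_rel K"

definition green_identity ::
  "(('a::complex_inner \<times> 'a) \<times> ('b::complex_inner \<times> 'b)) set \<Rightarrow> bool" where
  "green_identity \<Gamma> \<longleftrightarrow>
     (\<forall>f f' h h' g g' k k'. ((f, f'), (h, h')) \<in> \<Gamma> \<longrightarrow> ((g, g'), (k, k')) \<in> \<Gamma> \<longrightarrow>
        cinner f' g - cinner f g' = cinner h' k - cinner h k')"

definition Gamma0_ran :: "(('a \<times> 'a) \<times> ('b \<times> 'b)) set \<Rightarrow> 'b set" where
  "Gamma0_ran \<Gamma> = {h. \<exists>fh h'. (fh, (h, h')) \<in> \<Gamma>}"

definition Gamma0_ker :: "(('a \<times> 'a) \<times> ('b::zero \<times> 'b)) set \<Rightarrow> ('a \<times> 'a) set" where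
  "Gamma0_ker \<Gamma> = {fh. \<exists>h'. (fh, (0, h')) \<in> \<Gamma>}"

definition B_generalized_boundary_pair ::
  "('a::complex_inner \<times> 'a) set \<Rightarrow> (('a \<times> 'a) \<times> ('b::complex_inner \<times> 'b)) set \<Rightarrow> bool" where
  "B_generalized_boundary_pair A \<Gamma> \<longleftrightarrow>
     csubspace \<Gamma> \<and> Domain \<Gamma> \<subseteq> adj_rel A \<and> adj_rel A \<subseteq> closure (Domain \<Gamma>) \<and>
     green_identity \<Gamma> \<and> Gamma0_ran \<Gamma> = UNIV \<and> selfadjoint_rel (Gamma0_ker \<Gamma>)"

definition weyl_family ::
  "(('a::complex_vector \<times> 'a) \<times> ('b \<times> 'b)) set \<Rightarrow> complex \<Rightarrow> ('b \<times> 'b) set" where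
  "weyl_family \<Gamma> l = {(h, h'). \<exists>f. ((f, l *\<^sub>C f), (h, h')) \<in> \<Gamma>}"

definition weyl_op ::
  "(('a::complex_vector \<times> 'a) \<times> ('b \<times> 'b)) set \<Rightarrow> complex \<Rightarrow> 'b \<Rightarrow> 'b" where
  "weyl_op \<Gamma> l h = (THE h'. (h, h') \<in> weyl_family \<Gamma> l)"

definition Hs_space ::
  "(('a::complex_vector \<times> 'a) \<times> ('b::complex_inner \<times> 'b)) set \<Rightarrow> complex \<Rightarrow> 'b set" where
  "Hs_space \<Gamma> l = closure (range (im_op (weyl_op \<Gamma> l)))"

text \<open>Ordinary boundary triple {K, G0, G1} for A*, with K a subspace of the Hilbert space 'b.\<close>
definition ordinary_boundary_triple ::
  "('a::complex_inner \<times> 'a) set \<Rightarrow> 'b::complex_inner set \<Rightarrow>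
   ('a \<times> 'a \<Rightarrow> 'b) \<Rightarrow> ('a \<times> 'a \<Rightarrow> 'b) \<Rightarrow> bool" where
  "ordinary_boundary_triple A K G0 G1 \<longleftrightarrow>
     (\<forall>fh\<in>adj_rel A. G0 fh \<in> K \<and> G1 fh \<in> K) \<and>
     (\<forall>fh\<in>adj_rel A. \<forall>gh\<in>adj_rel A. G0 (fh + gh) = G0 fh + G0 gh \<and> G1 (fh + gh) = G1 fh + G1 gh) \<and>
     (\<forall>c. \<forall>fh\<in>adj_rel A. G0 (c *\<^sub>C fh) = c *\<^sub>C G0 fh \<and> G1 (c *\<^sub>C fh) = c *\<^sub>C G1 fh) \<and>
     (\<forall>f f' g g'. (f, f') \<in> adj_rel A \<longrightarrow> (g, g') \<in> adj_rel A \<longrightarrow>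
        cinner f' g - cinner f g' = cinner (G1 (f, f')) (G0 (g, g')) - cinner (G0 (f, f')) (G1 (g, g'))) \<and>
     (\<lambda>fh. (G0 fh, G1 fh)) ` adj_rel A = K \<times> K"

definition weyl_function ::
  "('a::complex_inner \<times> 'a) set \<Rightarrow> ('a \<times> 'a \<Rightarrow> 'b) \<Rightarrow> ('a \<times> 'a \<Rightarrow> 'b) \<Rightarrow> complex \<Rightarrow> 'b \<Rightarrow> 'b" where
  "weyl_function A G0 G1 l k =
     (THE k'. \<exists>f. (f, l *\<^sub>C f) \<in> adj_rel A \<and> G0 (f, l *\<^sub>C f) = k \<and> G1 (f, l *\<^sub>C f) = k')"

end

theory Submission
  imports Defs
begin

text \<open>
  Write \<open>A0 = ker \<Gamma>\<^sub>0\<close>, and let \<open>\<gamma>(z) h\<close> be the vector \<open>f\<close> with \<open>((f, z f), (h, M(z) h)) \<in> \<Gamma>\<close>.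
  Since \<open>A0\<close> is selfadjoint, every element of \<open>A\<^sup>*\<close> splits uniquely into an element of \<open>A0\<close> and
  an eigenpair \<open>(n, z n)\<close>, and the \<open>n\<close> that occur form the closure of \<open>ran \<gamma>(z)\<close>. Green's identity
  gives \<open>Im M(z) = Im z \<cdot> \<gamma>(z)\<^sup>*\<gamma>(z)\<close>, so \<open>\<H>\<^sub>s\<close> is the orthogonal complement of
  \<open>ker \<gamma>(z) = dom mul \<Gamma>\<close>, which does not depend on \<open>z\<close>. At \<open>z = \<i>\<close> take \<open>G = |\<gamma>(\<i>)|\<close> and \<open>E = Re M(\<i>)\<close>.
  The polar decomposition supplies a partial isometry \<open>B\<close> with \<open>B \<gamma>(\<i>) = G\<close>; for \<open>(f, f') \<in> A\<^sup>*\<close> with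
  \<open>\<i>\<close>-eigencomponent \<open>n\<close>, the maps \<open>B n\<close> and \<open>B (f' + \<i> f) - \<i> B n\<close> are the ordinary boundary triple
  whose Weyl function at \<open>\<i>\<close> is multiplication by \<open>\<i>\<close>.\<close>

section \<open>Complex inner product spaces\<close>

instance chilbert \<subseteq> banach ..

lemma scaleC_zero_left [simp]: "0 *\<^sub>C (x::'a::complex_vector) = 0"
  using scaleC_add_left[of 0 0 x] by simp

lemma scaleC_zero_right [simp]: "c *\<^sub>C (0::'a::complex_vector) = 0"
  using scaleC_add_right[of c 0 "0::'a"] by simp

lemma scaleC_minus_left [simp]: "(- c) *\<^sub>C (x::'a::complex_vector) = - (c *\<^sub>C x)"
  using scaleC_add_left[of "-c" c x] by (simp add: eq_neg_iff_add_eq_0)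

lemma scaleC_minus_right [simp]: "c *\<^sub>C (- x::'a::complex_vector) = - (c *\<^sub>C x)"
  using scaleC_add_right[of c "-x" x] by (simp add: eq_neg_iff_add_eq_0)

lemma scaleC_diff_right: "c *\<^sub>C (x - y::'a::complex_vector) = c *\<^sub>C x - c *\<^sub>C y"
  using scaleC_add_right[of c x "-y"] by simp

lemma scaleC_diff_left: "(c - d) *\<^sub>C (x::'a::complex_vector) = c *\<^sub>C x - d *\<^sub>C x"
  using scaleC_add_left[of c "-d" x] by simp

lemma cinner_zero_left [simp]: "cinner 0 (y::'a::complex_inner) = 0"
  using cinner_scaleC_left[of 0 0 y] by simp

lemma cinner_zero_right [simp]: "cinner (y::'a::complex_inner) 0 = 0"
  using cinner_commute[of y 0] by simp

lemma cinner_add_right: "cinner (x::'a::complex_inner) (y + z) = cinner x y + cinner x z"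
  using cinner_commute[of x "y + z"] cinner_commute[of x y] cinner_commute[of x z]
  by (simp add: cinner_add_left)

lemma cinner_scaleC_right: "cinner (x::'a::complex_inner) (c *\<^sub>C y) = cnj c * cinner x y"
  using cinner_commute[of x "c *\<^sub>C y"] cinner_commute[of x y] by (simp add: cinner_scaleC_left)

lemma cinner_minus_left [simp]: "cinner (- x) (y::'a::complex_inner) = - cinner x y"
  using cinner_scaleC_left[of "-1" x y] by (simp add: scaleC_one)

lemma cinner_minus_right [simp]: "cinner (x::'a::complex_inner) (- y) = - cinner x y"
  using cinner_scaleC_right[of x "-1" y] by (simp add: scaleC_one)

lemma cinner_diff_left: "cinner (x - y) (z::'a::complex_inner) = cinner x z - cinner y z"
  using cinner_add_left[of x "-y" z] by simp

lemma cinner_diff_right: "cinner (x::'a::complex_inner) (y - z) = cinner x y - cinner x z"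
  using cinner_add_right[of x y "-z"] by simp

lemmas cinner_simps = cinner_add_left cinner_add_right cinner_diff_left cinner_diff_right
  cinner_scaleC_left cinner_scaleC_right

lemmas scaleC_simps = scaleC_add_left scaleC_add_right scaleC_diff_left scaleC_diff_right
  scaleC_scaleC scaleC_one

lemma cinner_self: "cinner x (x::'a::complex_inner) = complex_of_real ((norm x)\<^sup>2)"
  using cinner_nonneg[of x] norm_eq_sqrt_cinner[of x] by (simp add: complex_eq_iff)

lemma norm_sq_cinner: "(norm (x::'a::complex_inner))\<^sup>2 = Re (cinner x x)"
  by (simp add: cinner_self)

lemma norm_scaleC [simp]: "norm (c *\<^sub>C (x::'a::complex_inner)) = cmod c * norm x"
proof -
  have "cinner (c *\<^sub>C x) (c *\<^sub>C x) = complex_of_real ((cmod c)\<^sup>2) * complex_of_real ((norm x)\<^sup>2)"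
    unfolding cinner_scaleC_left cinner_scaleC_right complex_norm_square
    by (simp add: cinner_self mult.assoc[symmetric])
  then have "(norm (c *\<^sub>C x))\<^sup>2 = (cmod c * norm x)\<^sup>2"
    by (simp add: norm_sq_cinner[of "c *\<^sub>C x"] power_mult_distrib)
  then show ?thesis by simp
qed

lemma norm_diff_sq:
  "(norm (x - y::'a::complex_inner))\<^sup>2 = (norm x)\<^sup>2 - 2 * Re (cinner x y) + (norm y)\<^sup>2"
  using cinner_commute[of y x] by (simp add: norm_sq_cinner cinner_simps)

lemma norm_add_sq:
  "(norm (x + y::'a::complex_inner))\<^sup>2 = (norm x)\<^sup>2 + 2 * Re (cinner x y) + (norm y)\<^sup>2"
  using norm_diff_sq[of x "-y"] by simp

text \<open>The coefficient is that of the orthogonal projection of \<open>x\<close> onto the line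
  through \<open>y\<close>. The same computation serves Cauchy-Schwarz and the minimality argument
  in the projection theorem.\<close>

lemma norm_sub_projection_sq:
  fixes x y :: "'a::complex_inner"
  assumes "y \<noteq> 0"
  shows "(norm (x - (cinner x y / cinner y y) *\<^sub>C y))\<^sup>2 = (norm x)\<^sup>2 - (cmod (cinner x y))\<^sup>2 / (norm y)\<^sup>2"
proof -
  define c where "c = cinner x y / cinner y y"
  have "cinner x (c *\<^sub>C y) = complex_of_real ((cmod (cinner x y))\<^sup>2 / (norm y)\<^sup>2)"
    using complex_norm_square[of "cinner x y"]
    by (simp add: cinner_scaleC_right c_def cinner_self mult.commute)
  moreover have "norm (c *\<^sub>C y) = cmod (cinner x y) / norm y"
    using assms unfolding norm_scaleC c_def cinner_self norm_divide norm_of_real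
    by (simp add: power2_eq_square)
  then have "(norm (c *\<^sub>C y))\<^sup>2 = (cmod (cinner x y))\<^sup>2 / (norm y)\<^sup>2"
    by (simp only: power_divide)
  ultimately show ?thesis
    unfolding c_def[symmetric] by (simp add: norm_diff_sq)
qed

lemma cinner_cauchy_schwarz: "cmod (cinner x y) \<le> norm x * norm (y::'a::complex_inner)"
proof (cases "y = 0")
  case False
  have "0 \<le> (norm x)\<^sup>2 - (cmod (cinner x y))\<^sup>2 / (norm y)\<^sup>2"
    by (metis False norm_sub_projection_sq zero_le_power2)
  then have "(cmod (cinner x y))\<^sup>2 \<le> (norm x * norm y)\<^sup>2"
    using False by (simp add: field_simps power_mult_distrib)
  then show ?thesis
    by (rule power2_le_imp_le) simp
qed simp

text \<open>Bilinearity here is over the reals, which conjugate-linearity in the second argument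
  does not disturb; this opens the general limit and continuity rules to
  \<open>cinner\<close>.\<close>

lemma bounded_bilinear_cinner: "bounded_bilinear (cinner :: 'a::complex_inner \<Rightarrow> 'a \<Rightarrow> complex)"
proof
  show "\<exists>K. \<forall>x y. norm (cinner x (y::'a)) \<le> norm x * norm y * K"
    using cinner_cauchy_schwarz by (intro exI[of _ 1] allI) simp
qed (simp_all add: cinner_simps scaleR_scaleC scaleR_conv_of_real)

lemmas tendsto_cinner = bounded_bilinear.tendsto[OF bounded_bilinear_cinner]
lemmas continuous_on_cinner = bounded_bilinear.continuous_on[OF bounded_bilinear_cinner]

lemma bounded_linear_scaleC: "bounded_linear (\<lambda>x::'a::complex_inner. c *\<^sub>C x)"
  by (rule bounded_linear_intro[of _ "cmod c"])
     (simp_all add: scaleC_simps scaleR_scaleC mult.commute)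

lemmas tendsto_scaleC = bounded_linear.tendsto[OF bounded_linear_scaleC]

lemma cinner_eq_zero_commute: "cinner x y = 0 \<longleftrightarrow> cinner y (x::'a::complex_inner) = 0"
  by (metis cinner_commute complex_cnj_zero)

lemma cinner_ext: "(\<And>z. cinner x z = cinner y z) \<Longrightarrow> x = (y::'a::complex_inner)"
  using cinner_eq_zero_iff[of "x - y"] by (simp add: cinner_diff_left)

lemma cinner_ext_right: "(\<And>z. cinner z x = cinner z y) \<Longrightarrow> x = (y::'a::complex_inner)"
  using cinner_eq_zero_iff[of "x - y"] by (simp add: cinner_diff_right)

section \<open>Complex subspaces and linear maps\<close>

lemma csubspace_diff: "csubspace S \<Longrightarrow> x \<in> S \<Longrightarrow> y \<in> S \<Longrightarrow> x - y \<in> S"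
  unfolding csubspace_def
  by (metis add_uminus_conv_diff scaleC_minus_left scaleC_one)

lemma clinear_zero: "clinear T \<Longrightarrow> T 0 = 0"
  unfolding clinear_def by (metis scaleC_zero_left)

lemma clinear_diff: "clinear T \<Longrightarrow> T (x - y) = T x - T y"
  unfolding clinear_def by (metis diff_add_cancel add_diff_cancel)

lemma clinear_scaleR: "clinear T \<Longrightarrow> T (r *\<^sub>R x) = r *\<^sub>R T x"
  by (simp add: clinear_def scaleR_scaleC)

lemma bounded_clinear_clinear: "bounded_clinear T \<Longrightarrow> clinear T"
  by (simp add: bounded_clinear_def)

lemma bounded_clinear_bounded_linear: "bounded_clinear T \<Longrightarrow> bounded_linear T"
  unfolding bounded_clinear_def by (auto simp: clinear_def scaleR_scaleC intro: bounded_linear_intro[of T])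

lemma csubspace_range: "clinear T \<Longrightarrow> csubspace (range T)"
  using clinear_zero[of T] unfolding csubspace_def clinear_def
  by (auto simp: image_iff) (metis, metis)+

lemma csubspace_closure:
  fixes S :: "'a::complex_inner set"
  assumes "csubspace S"
  shows "csubspace (closure S)"
  unfolding csubspace_def
proof (intro conjI ballI allI)
  show "0 \<in> closure S"
    using assms closure_subset by (auto simp: csubspace_def)
next
  fix x y assume "x \<in> closure S" "y \<in> closure S"
  then obtain u v where "\<And>n::nat. u n \<in> S" "u \<longlonglongrightarrow> x" "\<And>n::nat. v n \<in> S" "v \<longlonglongrightarrow> y"
    by (metis closure_sequential)
  then show "x + y \<in> closure S"
    using assms unfolding closure_sequential csubspace_def
    by (intro exI[of _ "\<lambda>n. u n + v n"] conjI tendsto_add) simp_all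
next
  fix c x assume "x \<in> closure S"
  then obtain u where "\<And>n::nat. u n \<in> S" "u \<longlonglongrightarrow> x"
    by (metis closure_sequential)
  then show "c *\<^sub>C x \<in> closure S"
    using assms unfolding closure_sequential csubspace_def
    by (intro exI[of _ "\<lambda>n. c *\<^sub>C u n"] conjI tendsto_scaleC) simp_all
qed

lemma closed_orth: "closed (orth (S::'a::complex_inner set))"
proof -
  have "orth S = (\<Inter>k\<in>S. {h. cinner h k = 0})"
    by (auto simp: orth_def)
  moreover have "closed {h. cinner h k = 0}" for k :: 'a
    by (intro closed_Collect_eq continuous_on_cinner continuous_intros)
  ultimately show ?thesis by auto
qed

text \<open>\<open>cadjoint\<close> is a definite description, so each adjoint used below is
  identified by exhibiting its value; uniqueness is nondegeneracy of the inner product.\<close>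

lemma cadjoint_eqI:
  assumes "\<And>x. cinner (T x) y = cinner x (z::'a::complex_inner)"
  shows "cadjoint T y = z"
  unfolding cadjoint_def
  by (rule the_equality) (use assms in \<open>auto intro: cinner_ext_right\<close>)

section \<open>Orthogonal projection\<close>

text \<open>A sequence in \<open>S\<close> whose distances to \<open>x\<close> approach the infimum
  is Cauchy by the parallelogram law; its limit is a nearest point, and there the residual is
  orthogonal to \<open>S\<close>.\<close>

theorem orthogonal_projection_exists:
  fixes S :: "'a::chilbert set"
  assumes S: "csubspace S" "closed S"
  obtains p where "p \<in> S" "x - p \<in> orth S"
proof -
  have ne: "S \<noteq> {}" using S by (auto simp: csubspace_def)
  define d where "d = infdist x S"
  have d0: "0 \<le> d" by (simp add: d_def infdist_nonneg)
  have dle: "d \<le> norm (x - s)" if "s \<in> S" for s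
    using infdist_le[OF that, of x] by (simp add: d_def dist_norm)
  have "\<exists>s\<in>S. norm (x - s) < d + 1 / real (Suc n)" for n
  proof (rule ccontr)
    assume "\<not> (\<exists>s\<in>S. norm (x - s) < d + 1 / real (Suc n))"
    then have "d + 1 / real (Suc n) \<le> d"
      unfolding d_def infdist_notempty[OF ne]
      by (intro cINF_greatest[OF ne]) (force simp: dist_norm)
    then show False by simp
  qed
  then obtain s where s: "\<And>n. s n \<in> S" "\<And>n. norm (x - s n) < d + 1 / real (Suc n)"
    by metis
  have lim: "(\<lambda>n. norm (x - s n)) \<longlonglongrightarrow> d"
  proof (rule real_tendsto_sandwich[OF _ _ tendsto_const])
    show "(\<lambda>n. d + 1 / real (Suc n)) \<longlonglongrightarrow> d"
      using tendsto_add[OF tendsto_const LIMSEQ_inverse_real_of_nat, of d]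
      by (simp add: inverse_eq_divide)
  qed (use s dle in \<open>auto intro!: always_eventually less_imp_le\<close>)
  \<comment> \<open>Parallelogram law for the residuals \<open>x - s m\<close> and
    \<open>x - s n\<close>: the midpoint of \<open>s m\<close> and \<open>s n\<close> lies in
    \<open>S\<close>, so the sum of the residuals has norm at least \<open>2 * d\<close>.\<close>
  have par: "(norm (s m - s n))\<^sup>2 \<le> 2 * ((norm (x - s m))\<^sup>2 - d\<^sup>2) + 2 * ((norm (x - s n))\<^sup>2 - d\<^sup>2)" for m n
  proof -
    have "(1/2) *\<^sub>R (s m + s n) \<in> S"
      using S s by (simp add: csubspace_def scaleR_scaleC)
    then have "d \<le> norm (x - (1/2) *\<^sub>R (s m + s n))" by (rule dle)
    also have "x - (1/2) *\<^sub>R (s m + s n) = (1/2) *\<^sub>R ((x - s m) + (x - s n))"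
      using scaleR_half_double[of x]
      by (simp add: scaleR_right_distrib scaleR_right_diff_distrib algebra_simps)
    finally have "2 * d \<le> norm ((x - s m) + (x - s n))" by simp
    then have "(2 * d)\<^sup>2 \<le> (norm ((x - s m) + (x - s n)))\<^sup>2"
      using d0 by (intro power_mono) auto
    moreover have "(norm (s m - s n))\<^sup>2 = (norm ((x - s n) - (x - s m)))\<^sup>2" by simp
    ultimately show ?thesis
      using cinner_commute[of "x - s m" "x - s n"]
      unfolding norm_add_sq norm_diff_sq[of "x - s n" "x - s m"] by (simp add: power_mult_distrib)
  qed
  have "Cauchy s"
  proof (rule metric_CauchyI)
    fix e :: real assume "0 < e"
    have "(\<lambda>n. (norm (x - s n))\<^sup>2 - d\<^sup>2) \<longlonglongrightarrow> d\<^sup>2 - d\<^sup>2"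
      by (intro tendsto_intros lim)
    then have "\<forall>\<^sub>F n in sequentially. (norm (x - s n))\<^sup>2 - d\<^sup>2 < e\<^sup>2 / 4"
      using \<open>0 < e\<close> by (intro order_tendstoD(2)) auto
    then obtain N where N: "\<And>n. n \<ge> N \<Longrightarrow> (norm (x - s n))\<^sup>2 - d\<^sup>2 < e\<^sup>2 / 4"
      by (auto simp: eventually_sequentially)
    have "dist (s m) (s n) < e" if "m \<ge> N" "n \<ge> N" for m n
    proof -
      have "(norm (s m - s n))\<^sup>2 < e\<^sup>2"
        using par[of m n] N[OF that(1)] N[OF that(2)] by simp
      then show ?thesis
        using \<open>0 < e\<close> by (simp add: dist_norm power2_less_imp_less)
    qed
    then show "\<exists>N. \<forall>m\<ge>N. \<forall>n\<ge>N. dist (s m) (s n) < e" by blast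
  qed
  then obtain p where p: "s \<longlonglongrightarrow> p"
    using Cauchy_convergent_iff convergent_def by blast
  have pS: "p \<in> S" using closed_sequentially[OF S(2) _ p] s(1) by blast
  have "norm (x - p) = d"
    using LIMSEQ_unique[OF tendsto_norm[OF tendsto_diff[OF tendsto_const p]] lim] .
  moreover have "x - p \<in> orth S"
    unfolding orth_def
  proof safe
    fix k assume k: "k \<in> S"
    show "cinner (x - p) k = 0"
    proof (rule ccontr)
      assume nz: "cinner (x - p) k \<noteq> 0"
      then have k0: "k \<noteq> 0" by auto
      \<comment> \<open>Moving \<open>p\<close> by the component of the residual along
        \<open>k\<close> would strictly lower the distance, against \<open>dle\<close>.\<close>
      define c where "c = cinner (x - p) k / cinner k k"
      have "p + c *\<^sub>C k \<in> S" using S pS k by (simp add: csubspace_def)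
      from dle[OF this] have "d \<le> norm ((x - p) - c *\<^sub>C k)" by (simp add: diff_diff_eq)
      then have "d\<^sup>2 \<le> (norm ((x - p) - c *\<^sub>C k))\<^sup>2" using d0 by (intro power_mono)
      also have "\<dots> = d\<^sup>2 - (cmod (cinner (x - p) k))\<^sup>2 / (norm k)\<^sup>2"
        unfolding c_def norm_sub_projection_sq[OF k0] \<open>norm (x - p) = d\<close> ..
      finally show False using nz k0 by (simp add: field_simps)
    qed
  qed
  ultimately show thesis using that pS by blast
qed

section \<open>Density, kernels and ranges\<close>

lemma closure_eq_UNIV_if_orth_trivial:
  fixes S :: "'a::chilbert set"
  assumes "csubspace S" "\<And>x. x \<in> orth S \<Longrightarrow> x = 0"
  shows "closure S = UNIV"
proof -
  have "x \<in> closure S" for x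
  proof -
    obtain p where p: "p \<in> closure S" "x - p \<in> orth (closure S)"
      using orthogonal_projection_exists[OF csubspace_closure[OF assms(1)] closed_closure] .
    then have "x - p \<in> orth S" using closure_subset by (auto simp: orth_def)
    then have "x = p" using assms(2) by fastforce
    then show ?thesis using p by simp
  qed
  then show ?thesis by auto
qed

text \<open>For \<open>x\<close> orthogonal to the kernel, let \<open>p\<close> be its projection
  onto the closed range. Symmetry puts \<open>x - p\<close> into the kernel, while \<open>x\<close>
  and \<open>p\<close> are both orthogonal to the kernel, so \<open>x - p\<close> is orthogonal to
  itself.\<close>

lemma closure_range_eq_orth_kernel:
  fixes T :: "'a::chilbert \<Rightarrow> 'a"
  assumes T: "clinear T" and sym: "\<And>x y. cinner (T x) y = cinner x (T y)"
  shows "closure (range T) = orth {x. T x = 0}"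
proof
  have "range T \<subseteq> orth {x. T x = 0}"
    by (auto simp: orth_def sym)
  then show "closure (range T) \<subseteq> orth {x. T x = 0}"
    by (rule closure_minimal[OF _ closed_orth])
next
  show "orth {x. T x = 0} \<subseteq> closure (range T)"
  proof
    fix x assume x: "x \<in> orth {x. T x = 0}"
    obtain p where p: "p \<in> closure (range T)" "x - p \<in> orth (closure (range T))"
      using orthogonal_projection_exists[OF csubspace_closure[OF csubspace_range[OF T]] closed_closure] .
    have ran: "T y \<in> closure (range T)" for y
      using closure_subset[of "range T"] by blast
    have "cinner (T (x - p)) y = 0" for y
      using p(2) ran[of y] by (simp add: sym orth_def)
    then have T0: "T (x - p) = 0" by (metis cinner_eq_zero_iff)
    have "closure (range T) \<subseteq> orth {x. T x = 0}"
      by (rule closure_minimal[OF _ closed_orth]) (auto simp: orth_def sym)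
    then have "cinner (x - p) (x - p) = 0"
      using x p(1) T0 unfolding orth_def cinner_diff_left[of x p] by auto
    then show "x \<in> closure (range T)"
      using p(1) by (simp add: cinner_eq_zero_iff)
  qed
qed

lemma orth_closure_range:
  fixes T :: "'a::complex_inner \<Rightarrow> 'a"
  assumes sym: "\<And>x y. cinner (T x) y = cinner x (T y)"
  shows "orth (closure (range T)) = {x. T x = 0}"
proof
  show "orth (closure (range T)) \<subseteq> {x. T x = 0}"
  proof
    fix x assume "x \<in> orth (closure (range T))"
    \<comment> \<open>Testing \<open>x\<close> against \<open>T (T x)\<close> turns orthogonality to
      the range into \<open>T x = 0\<close>.\<close>
    then have "cinner x (T (T x)) = 0"
      using closure_subset[of "range T"] by (auto simp: orth_def)
    then have "cinner (T x) (T x) = 0" by (simp only: sym)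
    then show "x \<in> {x. T x = 0}" by (simp only: cinner_eq_zero_iff mem_Collect_eq)
  qed
  have "range T \<subseteq> orth {x. T x = 0}"
    by (auto simp: orth_def sym)
  then have "closure (range T) \<subseteq> orth {x. T x = 0}"
    by (rule closure_minimal[OF _ closed_orth])
  then show "{x. T x = 0} \<subseteq> orth (closure (range T))"
    unfolding orth_def using cinner_eq_zero_commute by blast
qed

section \<open>Bounded operators\<close>

text \<open>The sublevel sets \<open>F n\<close> are closed, since the norm of \<open>S x\<close> is
  the supremum of |<x, T y>| over the unit ball, and they cover the space. Baire's theorem gives one
  of them an interior point, and linearity moves that ball to the origin.\<close>

theorem hellinger_toeplitz:
  fixes S :: "'a::chilbert \<Rightarrow> 'b::complex_inner"
  assumes S: "clinear S" and adj: "\<And>x y. cinner (S x) y = cinner x (T y)"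
  shows "bounded_clinear S"
proof -
  define F where "F n = {x. norm (S x) \<le> real n}" for n
  have cl: "closed (F n)" for n
  proof -
    have "F n = (\<Inter>y\<in>{y. norm y \<le> 1}. {x. cmod (cinner x (T y)) \<le> real n})"
    proof (intro set_eqI iffI)
      fix x assume "x \<in> F n"
      then have Sx: "norm (S x) \<le> real n" by (simp add: F_def)
      have "cmod (cinner x (T y)) \<le> real n" if "norm y \<le> 1" for y
      proof -
        have "cmod (cinner x (T y)) \<le> norm (S x) * norm y"
          unfolding adj[symmetric] by (rule cinner_cauchy_schwarz)
        also have "\<dots> \<le> norm (S x) * 1" using that by (intro mult_left_mono) auto
        finally show ?thesis using Sx by simp
      qed
      then show "x \<in> (\<Inter>y\<in>{y. norm y \<le> 1}. {x. cmod (cinner x (T y)) \<le> real n})" by blast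
    next
      fix x assume x: "x \<in> (\<Inter>y\<in>{y. norm y \<le> 1}. {x. cmod (cinner x (T y)) \<le> real n})"
      show "x \<in> F n"
      proof (cases "S x = 0")
        case False
        \<comment> \<open>The normalized image attains the supremum: pairing \<open>S x\<close> with
          it returns the norm of \<open>S x\<close>.\<close>
        define y where "y = complex_of_real (1 / norm (S x)) *\<^sub>C S x"
        have "norm y = 1" using False by (simp add: y_def norm_divide)
        then have "cmod (cinner x (T y)) \<le> real n" using x by auto
        also have "cinner x (T y) = cinner (S x) y" by (simp only: adj)
        also have "cinner (S x) y = complex_of_real (norm (S x))"
        proof -
          have "cinner (S x) y = complex_of_real (1 / norm (S x) * (norm (S x))\<^sup>2)"
            unfolding y_def cinner_scaleC_right cinner_self complex_cnj_complex_of_real of_real_mult ..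
          also have "1 / norm (S x) * (norm (S x))\<^sup>2 = norm (S x)"
            using False by (simp add: power2_eq_square)
          finally show ?thesis .
        qed
        finally show ?thesis by (simp add: F_def)
      qed (simp add: F_def)
    qed
    moreover have "closed {x. cmod (cinner x (T y)) \<le> real n}" for y
      by (intro closed_Collect_le continuous_on_cinner continuous_intros)
    ultimately show ?thesis by auto
  qed
  have "\<exists>n. interior (F n) \<noteq> {}"
  proof (rule ccontr)
    assume "\<nexists>n. interior (F n) \<noteq> {}"
    then have int: "interior (F n) = {}" for n by blast
    have "euclidean interior_of \<Union>(range F) = {}"
    proof (rule Baire_category_alt)
      show "completely_metrizable_space (euclidean :: 'a topology) \<or>
          locally_compact_space (euclidean :: 'a topology) \<and> regular_space (euclidean :: 'a topology)"
        using completely_metrizable_space_euclidean by (rule disjI1)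
      fix D assume "D \<in> range F"
      then show "closedin euclidean D \<and> euclidean interior_of D = {}"
        using cl int by (metis closed_closedin imageE euclidean_interior_of)
    qed simp
    moreover have "\<Union>(range F) = UNIV"
    proof -
      have "x \<in> F (nat \<lceil>norm (S x)\<rceil>)" for x
        by (simp add: F_def real_nat_ceiling_ge)
      then show ?thesis by blast
    qed
    ultimately show False by simp
  qed
  then obtain n x0 r where r: "r > 0" "cball x0 r \<subseteq> F n"
    by (meson ex_in_conv mem_interior_cball)
  have bnd: "norm (S v) \<le> 2 * real n" if "norm v \<le> r" for v
  proof -
    have "x0 + v \<in> F n" "x0 \<in> F n" using r that by (auto simp: dist_norm)
    moreover have "S v = S (x0 + v) - S x0" using clinear_diff[OF S, of "x0 + v" x0] by simp
    ultimately show ?thesis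
      using norm_triangle_ineq4[of "S (x0 + v)" "S x0"] by (simp add: F_def)
  qed
  have "norm (S x) \<le> norm x * (2 * real n / r)" for x
  proof (cases "x = 0")
    case False
    have "norm (S ((r / norm x) *\<^sub>R x)) \<le> 2 * real n"
      using False r by (intro bnd) simp
    then show ?thesis
      using False r unfolding clinear_scaleR[OF S] by (simp add: field_simps)
  qed (simp add: clinear_zero[OF S])
  then show ?thesis using S unfolding bounded_clinear_def by blast
qed

section \<open>Operator square roots by iteration\<close>

text \<open>With \<open>X = 1 - P\<close>, the iteration \<open>Y \<mapsto> (X + Y\<^sup>2) / 2\<close> converges in norm to a solution of
  \<open>(1 - Y)\<^sup>2 = P\<close>, because its increments are dominated by those of the scalar iteration with
  \<open>X = 1\<close>, which is increasing and bounded by 1.\<close>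

fun sqrt_iter :: "'a::real_normed_vector \<Rightarrow>\<^sub>L 'a \<Rightarrow> nat \<Rightarrow> 'a \<Rightarrow>\<^sub>L 'a" where
  "sqrt_iter X 0 = 0"
| "sqrt_iter X (Suc n) = (1/2) *\<^sub>R (X + (sqrt_iter X n o\<^sub>L sqrt_iter X n))"

fun sqrt_iter_majorant :: "nat \<Rightarrow> real" where
  "sqrt_iter_majorant 0 = 0"
| "sqrt_iter_majorant (Suc n) = (1 + sqrt_iter_majorant n * sqrt_iter_majorant n) / 2"

lemma sqrt_iter_majorant_bounds: "0 \<le> sqrt_iter_majorant n" "sqrt_iter_majorant n \<le> 1"
proof (induction n)
  case (Suc n)
  { case 1 show ?case using Suc by simp }
  { case 2 show ?case using mult_mono[OF Suc(2,2)] Suc by simp }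
qed simp_all

text \<open>The increment of the scalar iteration at y is half the square of 1 - y.\<close>

lemma sqrt_iter_majorant_mono: "sqrt_iter_majorant n \<le> sqrt_iter_majorant (Suc n)"
proof -
  have "0 \<le> (1 - sqrt_iter_majorant n)\<^sup>2" by simp
  then show ?thesis by (simp add: power2_eq_square algebra_simps)
qed

lemma convergent_sqrt_iter_majorant: "convergent sqrt_iter_majorant"
proof (rule Bseq_mono_convergent)
  show "Bseq sqrt_iter_majorant"
    using sqrt_iter_majorant_bounds by (intro BseqI'[of _ 1]) auto
  show "\<forall>m n. m \<le> n \<longrightarrow> sqrt_iter_majorant m \<le> sqrt_iter_majorant n"
    using lift_Suc_mono_le[of sqrt_iter_majorant] sqrt_iter_majorant_mono by blast
qed

lemma norm_sqrt_iter:
  assumes "norm X \<le> 1"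
  shows "norm (sqrt_iter X n) \<le> sqrt_iter_majorant n"
proof (induction n)
  case (Suc n)
  have "norm (sqrt_iter X n o\<^sub>L sqrt_iter X n) \<le> norm (sqrt_iter X n) * norm (sqrt_iter X n)"
    by (rule norm_blinfun_compose)
  also have "\<dots> \<le> sqrt_iter_majorant n * sqrt_iter_majorant n"
    using Suc sqrt_iter_majorant_bounds by (intro mult_mono) auto
  finally show ?case
    using assms norm_triangle_ineq[of X "sqrt_iter X n o\<^sub>L sqrt_iter X n"] by simp
qed simp

text \<open>The difference Z^2 - Y^2 splits as Z (Z - Y) + (Z - Y) Y with no appeal to
  commutativity. Bounding both terms by their scalar counterparts gives, after halving, the next
  scalar increment.\<close>

lemma norm_sqrt_iter_increment:
  assumes X: "norm X \<le> 1"
  shows "norm (sqrt_iter X (Suc n) - sqrt_iter X n) \<le> sqrt_iter_majorant (Suc n) - sqrt_iter_majorant n"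
proof (induction n)
  case 0
  then show ?case using X by simp
next
  case (Suc n)
  define Y Z where "Y = sqrt_iter X n" and "Z = sqrt_iter X (Suc n)"
  define y z where "y = sqrt_iter_majorant n" and "z = sqrt_iter_majorant (Suc n)"
  have IH: "norm (Z - Y) \<le> z - y" using Suc by (simp only: Y_def Z_def y_def z_def)
  have nY: "norm Y \<le> y" and nZ: "norm Z \<le> z"
    using norm_sqrt_iter[OF X] by (simp_all only: Y_def Z_def y_def z_def)
  have "sqrt_iter X (Suc (Suc n)) - Z = (1/2) *\<^sub>R (X + (Z o\<^sub>L Z)) - (1/2) *\<^sub>R (X + (Y o\<^sub>L Y))"
    unfolding Y_def Z_def by (simp only: sqrt_iter.simps(2))
  also have "\<dots> = (1/2) *\<^sub>R ((Z o\<^sub>L (Z - Y)) + ((Z - Y) o\<^sub>L Y))"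
    unfolding scaleR_right_diff_distrib[symmetric]
    by (rule arg_cong[of _ _ "(*\<^sub>R) (1/2)"], rule blinfun_eqI) (simp add: blinfun.bilinear_simps)
  also have "norm \<dots> \<le> (1/2) * (z * (z - y) + (z - y) * y)"
  proof -
    have "norm (Z o\<^sub>L (Z - Y)) \<le> z * (z - y)"
      by (rule order_trans[OF norm_blinfun_compose mult_mono[OF nZ IH]])
         (use nZ norm_ge_zero[of Z] in linarith, simp)
    moreover have "norm ((Z - Y) o\<^sub>L Y) \<le> (z - y) * y"
      by (rule order_trans[OF norm_blinfun_compose mult_mono[OF IH nY]])
         (use IH norm_ge_zero[of "Z - Y"] in linarith, simp)
    ultimately show ?thesis
      using norm_triangle_ineq[of "Z o\<^sub>L (Z - Y)" "(Z - Y) o\<^sub>L Y"] by simp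
  qed
  also have "\<dots> = sqrt_iter_majorant (Suc (Suc n)) - z"
    by (simp add: z_def y_def field_simps)
  finally show ?case by (simp only: Z_def z_def)
qed

text \<open>Telescoping the increments makes the operator iteration at most as spread out as the
  convergent scalar one, so it inherits the Cauchy property.\<close>

lemma sqrt_iter_dist:
  assumes X: "norm X \<le> 1" and "m \<le> n"
  shows "dist (sqrt_iter X m) (sqrt_iter X n) \<le> dist (sqrt_iter_majorant m) (sqrt_iter_majorant n)"
proof -
  have "norm (sqrt_iter X n - sqrt_iter X m) \<le> sqrt_iter_majorant n - sqrt_iter_majorant m"
    using \<open>m \<le> n\<close>
  proof (induction n rule: dec_induct)
    case (step n)
    then show ?case
      using norm_sqrt_iter_increment[OF X, of n]
        norm_triangle_ineq[of "sqrt_iter X (Suc n) - sqrt_iter X n" "sqrt_iter X n - sqrt_iter X m"]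
      by (simp del: sqrt_iter.simps sqrt_iter_majorant.simps)
  qed simp
  then show ?thesis by (simp add: dist_norm norm_minus_commute)
qed

lemma convergent_sqrt_iter:
  fixes X :: "'a::banach \<Rightarrow>\<^sub>L 'a"
  assumes X: "norm X \<le> 1"
  shows "convergent (sqrt_iter X)"
  unfolding Cauchy_convergent_iff[symmetric]
proof (rule metric_CauchyI)
  fix e :: real assume "0 < e"
  then obtain N where N: "\<And>m n. m \<ge> N \<Longrightarrow> n \<ge> N \<Longrightarrow> dist (sqrt_iter_majorant m) (sqrt_iter_majorant n) < e"
    using convergent_sqrt_iter_majorant unfolding Cauchy_convergent_iff[symmetric] by (meson metric_CauchyD)
  have "dist (sqrt_iter X m) (sqrt_iter X n) < e" if "m \<ge> N" "n \<ge> N" for m n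
    using N[OF that] sqrt_iter_dist[OF X, of m n] sqrt_iter_dist[OF X, of n m]
    by (cases "m \<le> n") (auto simp: dist_commute)
  then show "\<exists>N. \<forall>m\<ge>N. \<forall>n\<ge>N. dist (sqrt_iter X m) (sqrt_iter X n) < e" by blast
qed

text \<open>The type of bounded linear functions is only real-linear, so complex homogeneity is
  carried through the iteration as a separate invariant.\<close>

lemma sqrt_iter_clinear:
  fixes X :: "'a::complex_inner \<Rightarrow>\<^sub>L 'a"
  assumes "\<And>c x. X (c *\<^sub>C x) = c *\<^sub>C X x"
  shows "sqrt_iter X n (c *\<^sub>C x) = c *\<^sub>C sqrt_iter X n x"
  by (induction n arbitrary: x)
     (simp_all add: assms blinfun.bilinear_simps scaleR_scaleC scaleC_simps mult.commute)

lemma sqrt_iter_symmetric: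
  fixes X :: "'a::complex_inner \<Rightarrow>\<^sub>L 'a"
  assumes "\<And>x y. cinner (X x) y = cinner x (X y)"
  shows "cinner (sqrt_iter X n x) y = cinner x (sqrt_iter X n y)"
  by (induction n arbitrary: x y)
     (simp_all add: assms blinfun.bilinear_simps scaleR_scaleC cinner_simps)

theorem selfadjoint_square_root:
  fixes X :: "'a::chilbert \<Rightarrow> 'a"
  assumes X: "clinear X" "\<And>x. norm (X x) \<le> norm x" and sym: "\<And>x y. cinner (X x) y = cinner x (X y)"
  obtains S where "bounded_clinear S" "\<And>x y. cinner (S x) y = cinner x (S y)" "\<And>x. S (S x) = x - X x"
proof -
  have bX: "bounded_linear X"
    using X by (intro bounded_clinear_bounded_linear) (auto simp: bounded_clinear_def intro!: exI[of _ 1])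
  define U where "U = Blinfun X"
  have U: "blinfun_apply U = X" using bX by (simp add: U_def bounded_linear_Blinfun_apply)
  have "norm U \<le> 1"
    by (rule norm_blinfun_bound) (use X(2) U in auto)
  then obtain Y where Y: "sqrt_iter U \<longlonglongrightarrow> Y"
    using convergent_sqrt_iter convergent_def by blast
  \<comment> \<open>Passing to the limit in the recursion shows 2 Y = X + Y^2, that is, (1 - Y)^2 =
    1 - X; hence the witness \<open>x - Y x\<close> below.\<close>
  have "(\<lambda>n. sqrt_iter U (Suc n)) \<longlonglongrightarrow> (1/2) *\<^sub>R (U + (Y o\<^sub>L Y))"
    unfolding sqrt_iter.simps
    by (intro tendsto_intros bounded_bilinear.tendsto[OF bounded_bilinear_blinfun_compose] Y)
  then have "Y = (1/2) *\<^sub>R (U + (Y o\<^sub>L Y))"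
    using LIMSEQ_unique LIMSEQ_Suc[OF Y] by blast
  then have "2 *\<^sub>R Y = U + (Y o\<^sub>L Y)"
    by (metis scaleR_one scaleR_scaleR nonzero_eq_divide_eq zero_neq_numeral mult.commute)
  then have fix2: "2 *\<^sub>R Y x = X x + Y (Y x)" for x
    by (metis U blinfun.add_left blinfun.scaleR_left blinfun_apply_blinfun_compose)
  have pt: "(\<lambda>n. sqrt_iter U n x) \<longlonglongrightarrow> Y x" for x
    by (intro blinfun.tendsto Y tendsto_const)
  have UC: "U (c *\<^sub>C x) = c *\<^sub>C U x" "cinner (U x) y = cinner x (U y)" for c x y
    using X(1) sym by (simp_all add: U clinear_def)
  have YC: "Y (c *\<^sub>C x) = c *\<^sub>C Y x" for c x
    using LIMSEQ_unique[OF pt[of "c *\<^sub>C x"]] tendsto_scaleC[OF pt[of x]]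
    by (simp add: sqrt_iter_clinear[OF UC(1)])
  have YS: "cinner (Y x) y = cinner x (Y y)" for x y
    using LIMSEQ_unique[OF tendsto_cinner[OF pt[of x] tendsto_const[of y]]]
      tendsto_cinner[OF tendsto_const[of x] pt[of y]]
    by (simp add: sqrt_iter_symmetric[OF UC(2)])
  show thesis
  proof
    have "clinear (\<lambda>x. x - Y x)"
      by (simp add: clinear_def blinfun.bilinear_simps YC scaleC_simps)
    moreover have "norm (x - Y x) \<le> norm x * (1 + norm Y)" for x
      using norm_triangle_ineq4[of x "Y x"] norm_blinfun[of Y x] by (simp add: algebra_simps)
    ultimately show "bounded_clinear (\<lambda>x. x - Y x)"
      unfolding bounded_clinear_def by blast
    show "cinner (x - Y x) y = cinner x (y - Y y)" for x y
      by (simp add: cinner_simps YS)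
    show "x - Y x - Y (x - Y x) = x - X x" for x
      using fix2[of x] by (simp add: blinfun.bilinear_simps scaleR_2 algebra_simps)
  qed
qed

section \<open>Polar decomposition\<close>

text \<open>\<open>G\<close> is the modulus of \<open>g\<close>. With c a bound for
  \<open>g\<close>, the operator 1 - g* g / c^2 is a contraction, to which the square root theorem
  applies; the root is rescaled by c.\<close>

theorem modulus_exists:
  fixes g :: "'b::chilbert \<Rightarrow> 'a::complex_inner"
  assumes g: "bounded_clinear g" and adj: "\<And>h x. cinner (g h) x = cinner h (gs x)"
  obtains G where "bounded_clinear G" "\<And>h k. cinner (G h) k = cinner h (G k)" "\<And>h. G (G h) = gs (g h)"
proof -
  have gl: "clinear g" using g by (rule bounded_clinear_clinear)
  obtain K where K: "\<And>h. norm (g h) \<le> norm h * K" using g by (auto simp: bounded_clinear_def)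
  \<comment> \<open>The added 1 keeps the scaling factor positive even when \<open>K\<close> is
    not.\<close>
  define c where "c = \<bar>K\<bar> + 1"
  have c: "c > 0" by (simp add: c_def)
  have gc: "norm (g h) \<le> c * norm h" for h
  proof -
    have "norm h * K \<le> norm h * c" by (intro mult_left_mono) (auto simp: c_def)
    then show ?thesis using K[of h] by (simp add: mult.commute)
  qed
  have gsc: "norm (gs x) \<le> c * norm x" for x
  proof (cases "gs x = 0")
    case False
    have "norm (gs x) * norm (gs x) = cmod (cinner (g (gs x)) x)"
      unfolding adj cinner_self norm_of_real by (simp add: power2_eq_square)
    also have "\<dots> \<le> norm (g (gs x)) * norm x" by (rule cinner_cauchy_schwarz)
    also have "\<dots> \<le> (c * norm (gs x)) * norm x" by (intro mult_right_mono gc) simp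
    finally show ?thesis using False by (simp add: mult.commute mult.left_commute)
  qed (use c in simp)
  have gsl: "clinear gs"
    unfolding clinear_def
    by (intro conjI allI; rule cinner_ext_right) (simp_all add: adj[symmetric] cinner_simps)
  define X where "X h = h - complex_of_real (1 / c\<^sup>2) *\<^sub>C gs (g h)" for h
  have Xl: "clinear X"
    using gl gsl by (simp add: clinear_def X_def scaleC_simps mult.commute)
  have Xs: "cinner (X h) k = cinner h (X k)" for h k
  proof -
    have "cinner (gs (g h)) k = cinner h (gs (g k))"
      by (metis adj cinner_commute)
    then show ?thesis by (simp add: X_def cinner_simps)
  qed
  \<comment> \<open>Expanding the square, the cross term removes 2 |g h|^2 / c^2, while the
    quadratic term adds at most |g h|^2 / c^2 because \<open>gs\<close> is also bounded by
    c.\<close>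
  have Xn: "norm (X h) \<le> norm h" for h
  proof -
    have "Re (cinner h (complex_of_real (1 / c\<^sup>2) *\<^sub>C gs (g h))) = (norm (g h))\<^sup>2 / c\<^sup>2"
      by (simp only: cinner_scaleC_right adj[symmetric] cinner_self complex_cnj_complex_of_real
          of_real_mult[symmetric] Re_complex_of_real
          times_divide_eq_left mult_1_left)
    moreover have "(norm (complex_of_real (1 / c\<^sup>2) *\<^sub>C gs (g h)))\<^sup>2 \<le> (norm (g h))\<^sup>2 / c\<^sup>2"
    proof -
      have "norm (complex_of_real (1 / c\<^sup>2) *\<^sub>C gs (g h)) = norm (gs (g h)) / c\<^sup>2"
        using c by (simp add: norm_divide norm_power)
      also have "\<dots> \<le> c * norm (g h) / c\<^sup>2"
        by (intro divide_right_mono gsc) simp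
      also have "\<dots> = norm (g h) / c" using c by (simp add: power2_eq_square)
      finally have "(norm (complex_of_real (1 / c\<^sup>2) *\<^sub>C gs (g h)))\<^sup>2 \<le> (norm (g h) / c)\<^sup>2"
        by (intro power_mono) simp_all
      then show ?thesis by (simp only: power_divide)
    qed
    moreover have "0 \<le> (norm (g h))\<^sup>2 / c\<^sup>2" by simp
    ultimately have "(norm (X h))\<^sup>2 \<le> (norm h)\<^sup>2"
      unfolding X_def norm_diff_sq by linarith
    then show ?thesis by (rule power2_le_imp_le) simp
  qed
  obtain S where S: "bounded_clinear S" "\<And>x y. cinner (S x) y = cinner x (S y)" "\<And>x. S (S x) = x - X x"
    using selfadjoint_square_root[OF Xl Xn Xs] by blast
  have Sl: "clinear S" using S(1) by (rule bounded_clinear_clinear)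
  show thesis
  proof
    have "clinear (\<lambda>h. complex_of_real c *\<^sub>C S h)"
      using Sl by (simp add: clinear_def scaleC_simps mult.commute)
    moreover obtain L where L: "\<And>h. norm (S h) \<le> norm h * L" using S(1) by (auto simp: bounded_clinear_def)
    have "norm (complex_of_real c *\<^sub>C S h) \<le> norm h * (c * L)" for h
      using mult_left_mono[OF L[of h], of c] c by (simp add: algebra_simps)
    ultimately show "bounded_clinear (\<lambda>h. complex_of_real c *\<^sub>C S h)"
      unfolding bounded_clinear_def by blast
    show "cinner (complex_of_real c *\<^sub>C S h) k = cinner h (complex_of_real c *\<^sub>C S k)" for h k
      by (simp add: cinner_simps S(2))
    show "complex_of_real c *\<^sub>C S (complex_of_real c *\<^sub>C S h) = gs (g h)" for h
    proof -
      have "complex_of_real c *\<^sub>C S (complex_of_real c *\<^sub>C S h)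
          = complex_of_real (c * c * (1 / c\<^sup>2)) *\<^sub>C gs (g h)"
        using Sl S(3)[of h] by (simp add: clinear_def scaleC_simps X_def)
      also have "c * c * (1 / c\<^sup>2) = 1" using c by (simp add: power2_eq_square)
      finally show ?thesis by (simp add: scaleC_one)
    qed
  qed
qed

text \<open>Polarization: \<open>h + k\<close> yields the real part, and replacing \<open>h\<close>
  by \<i> times \<open>h\<close> yields the imaginary part.\<close>

lemma cinner_eq_if_norm_eq:
  assumes g: "clinear g" and G: "clinear G"
    and eq: "\<And>h. norm (g h :: 'a::complex_inner) = norm (G h :: 'c::complex_inner)"
  shows "cinner (g h) (g k) = cinner (G h) (G k)"
proof -
  have re: "Re (cinner (g h) (g k)) = Re (cinner (G h) (G k))" for h k
    using norm_add_sq[of "g h" "g k"] norm_add_sq[of "G h" "G k"] eq[of "h + k"] eq[of h] eq[of k] g G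
    by (simp add: clinear_def)
  have "Re (cinner (g (\<i> *\<^sub>C h)) (g k)) = Re (cinner (G (\<i> *\<^sub>C h)) (G k))" by (rule re)
  then have "Im (cinner (g h) (g k)) = Im (cinner (G h) (G k))"
    using g G by (simp add: clinear_def cinner_scaleC_left)
  then show ?thesis using re by (simp add: complex_eq_iff)
qed

text \<open>Sending \<open>g h\<close> to \<open>G h\<close> is isometric, so it extends to an
  isometry between the closed ranges; composing with the projection onto the closed range of
  \<open>g\<close> makes it everywhere defined. In the last property the component of
  \<open>x\<close> orthogonal to that range contributes nothing to either pairing.\<close>

theorem partial_isometry_exists:
  fixes g :: "'b::complex_vector \<Rightarrow> 'a::chilbert" and G :: "'b \<Rightarrow> 'c::chilbert"
  assumes g: "clinear g" and G: "clinear G" and eq: "\<And>h. norm (g h) = norm (G h)"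
  obtains B where "clinear B" "\<And>h. B (g h) = G h" "range B \<subseteq> closure (range G)"
    "closure (range G) \<subseteq> B ` closure (range g)"
    "\<And>x y. y \<in> closure (range g) \<Longrightarrow> cinner (B x) (B y) = cinner x y"
proof -
  \<comment> \<open>\<open>V\<close> is the graph of the extended isometry, described by one
    sequence of preimages whose images under \<open>g\<close> and \<open>G\<close> both
    converge.\<close>
  define V where "V x y \<longleftrightarrow> (\<exists>h::nat \<Rightarrow> 'b. (\<lambda>n. g (h n)) \<longlonglongrightarrow> x \<and> (\<lambda>n. G (h n)) \<longlonglongrightarrow> y)" for x y
  have dist_eq: "dist (g h) (g k) = dist (G h) (G k)" for h k
    unfolding dist_norm clinear_diff[OF g, symmetric] clinear_diff[OF G, symmetric] by (rule eq)
  have V_g: "V (g h) (G h)" for h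
    unfolding V_def by (intro exI[of _ "\<lambda>_. h"]) simp
  have V_left: "\<exists>y. V x y" if x: "x \<in> closure (range g)" for x
  proof -
    obtain u where u: "\<And>n::nat. u n \<in> range g" "u \<longlonglongrightarrow> x"
      using x unfolding closure_sequential by blast
    then have "\<forall>n. \<exists>h. u n = g h" by blast
    then obtain h where h: "\<And>n. u n = g (h n)" by metis
    then have ueq: "u = (\<lambda>n. g (h n))" by auto
    have "Cauchy u" using u(2) by (rule LIMSEQ_imp_Cauchy)
    then have "Cauchy (\<lambda>n. G (h n))" unfolding Cauchy_def h dist_eq .
    then obtain y where "(\<lambda>n. G (h n)) \<longlonglongrightarrow> y"
      using Cauchy_convergent_iff convergent_def by blast
    then show ?thesis using u(2) unfolding V_def ueq by blast
  qed
  have V_right: "\<exists>x. V x y" if y: "y \<in> closure (range G)" for y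
  proof -
    obtain u where u: "\<And>n::nat. u n \<in> range G" "u \<longlonglongrightarrow> y"
      using y unfolding closure_sequential by blast
    then have "\<forall>n. \<exists>h. u n = G h" by blast
    then obtain h where h: "\<And>n. u n = G (h n)" by metis
    then have ueq: "u = (\<lambda>n. G (h n))" by auto
    have "Cauchy u" using u(2) by (rule LIMSEQ_imp_Cauchy)
    then have "Cauchy (\<lambda>n. g (h n))" unfolding Cauchy_def h dist_eq .
    then obtain x where "(\<lambda>n. g (h n)) \<longlonglongrightarrow> x"
      using Cauchy_convergent_iff convergent_def by blast
    then show ?thesis using u(2) unfolding V_def ueq by blast
  qed
  have V_closure: "x \<in> closure (range g)" "y \<in> closure (range G)" if V: "V x y" for x y
  proof -
    obtain h :: "nat \<Rightarrow> 'b" where h: "(\<lambda>n. g (h n)) \<longlonglongrightarrow> x" "(\<lambda>n. G (h n)) \<longlonglongrightarrow> y"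
      using V unfolding V_def by blast
    show "x \<in> closure (range g)" "y \<in> closure (range G)"
      unfolding closure_sequential
      by (rule exI[of _ "\<lambda>n. g (h n)"], use h in simp)
         (rule exI[of _ "\<lambda>n. G (h n)"], use h in simp)
  qed
  have V_add: "V (x + x') (y + y')" if V: "V x y" "V x' y'" for x x' y y'
  proof -
    obtain h :: "nat \<Rightarrow> 'b" where "(\<lambda>n. g (h n)) \<longlonglongrightarrow> x" "(\<lambda>n. G (h n)) \<longlonglongrightarrow> y"
      using V(1) unfolding V_def by blast
    moreover obtain k :: "nat \<Rightarrow> 'b" where "(\<lambda>n. g (k n)) \<longlonglongrightarrow> x'" "(\<lambda>n. G (k n)) \<longlonglongrightarrow> y'"
      using V(2) unfolding V_def by blast
    ultimately have "(\<lambda>n. g (h n + k n)) \<longlonglongrightarrow> x + x'" "(\<lambda>n. G (h n + k n)) \<longlonglongrightarrow> y + y'"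
      using g G by (simp_all add: clinear_def tendsto_add)
    then show ?thesis unfolding V_def by (intro exI[of _ "\<lambda>n. h n + k n"] conjI)
  qed
  have V_scale: "V (c *\<^sub>C x) (c *\<^sub>C y)" if V: "V x y" for c x y
  proof -
    obtain h :: "nat \<Rightarrow> 'b" where "(\<lambda>n. g (h n)) \<longlonglongrightarrow> x" "(\<lambda>n. G (h n)) \<longlonglongrightarrow> y"
      using V unfolding V_def by blast
    then have "(\<lambda>n. g (c *\<^sub>C h n)) \<longlonglongrightarrow> c *\<^sub>C x" "(\<lambda>n. G (c *\<^sub>C h n)) \<longlonglongrightarrow> c *\<^sub>C y"
      using g G by (simp_all add: clinear_def tendsto_scaleC)
    then show ?thesis unfolding V_def by (intro exI[of _ "\<lambda>n. c *\<^sub>C h n"] conjI)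
  qed
  have V_cinner: "cinner x x' = cinner y y'" if V: "V x y" "V x' y'" for x x' y y'
  proof -
    obtain h :: "nat \<Rightarrow> 'b" where h: "(\<lambda>n. g (h n)) \<longlonglongrightarrow> x" "(\<lambda>n. G (h n)) \<longlonglongrightarrow> y"
      using V(1) unfolding V_def by blast
    obtain k :: "nat \<Rightarrow> 'b" where k: "(\<lambda>n. g (k n)) \<longlonglongrightarrow> x'" "(\<lambda>n. G (k n)) \<longlonglongrightarrow> y'"
      using V(2) unfolding V_def by blast
    have "(\<lambda>n. cinner (g (h n)) (g (k n))) \<longlonglongrightarrow> cinner x x'"
      by (intro tendsto_cinner h k)
    moreover have "(\<lambda>n. cinner (g (h n)) (g (k n))) \<longlonglongrightarrow> cinner y y'"
      unfolding cinner_eq_if_norm_eq[OF g G eq] by (intro tendsto_cinner h k)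
    ultimately show ?thesis by (rule LIMSEQ_unique)
  qed
  define N where "N = closure (range g)"
  have N: "csubspace N" "closed N"
    unfolding N_def by (simp_all add: csubspace_closure csubspace_range g)
  \<comment> \<open>\<open>W\<close> prefixes \<open>V\<close> with the orthogonal projection onto
    \<open>N\<close>. It is a linear relation, so \<open>W_0\<close> suffices for
    single-valuedness.\<close>
  define W where "W x y \<longleftrightarrow> (\<exists>p. x - p \<in> orth N \<and> V p y)" for x y
  have W_add: "W (x + x') (y + y')" if W: "W x y" "W x' y'" for x x' y y'
  proof -
    obtain p q where pq: "x - p \<in> orth N" "V p y" "x' - q \<in> orth N" "V q y'"
      using W unfolding W_def by blast
    have "(x + x') - (p + q) \<in> orth N"
      using pq(1,3) by (simp add: orth_def cinner_simps)
    then show ?thesis unfolding W_def using V_add[OF pq(2,4)] by blast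
  qed
  have W_scale: "W (c *\<^sub>C x) (c *\<^sub>C y)" if W: "W x y" for c x y
  proof -
    obtain p where p: "x - p \<in> orth N" "V p y"
      using W unfolding W_def by blast
    have "c *\<^sub>C x - c *\<^sub>C p \<in> orth N"
      using p(1) unfolding scaleC_diff_right[symmetric] by (simp add: orth_def cinner_scaleC_left)
    then show ?thesis unfolding W_def using V_scale[OF p(2)] by blast
  qed
  have W_total: "\<exists>y. W x y" for x
    using orthogonal_projection_exists[OF N, of x] V_left unfolding W_def N_def by metis
  have W_0: "y = 0" if W: "W 0 y" for y
  proof -
    obtain p where p: "0 - p \<in> orth N" "V p y"
      using W unfolding W_def by blast
    then have "cinner p p = 0" using V_closure(1)[OF p(2)] by (simp add: orth_def N_def)
    then have "cinner y y = 0" using V_cinner[OF p(2) p(2)] by simp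
    then show ?thesis by (simp only: cinner_eq_zero_iff)
  qed
  have W_unique: "y = y'" if W: "W x y" "W x y'" for x y y'
    using W_0[of "y - y'"] W_add[OF W(1) W_scale[OF W(2), of "-1"]] by (simp add: scaleC_one)
  define B where "B x = (THE y. W x y)" for x
  have WB: "W x (B x)" for x
    unfolding B_def using W_total[of x] W_unique by (metis the_equality)
  have B_eqI: "B x = y" if "W x y" for x y
    using W_unique[OF WB that] .
  have V_W: "W x y" if "V x y" for x y
    unfolding W_def using that by (intro exI[of _ x]) (simp add: orth_def)
  show thesis
  proof
    show "clinear B"
      unfolding clinear_def by (intro conjI allI B_eqI W_add W_scale WB)
    show "B (g h) = G h" for h by (intro B_eqI V_W V_g)
    show "range B \<subseteq> closure (range G)"
      using WB V_closure(2) unfolding W_def by blast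
    show "closure (range G) \<subseteq> B ` closure (range g)"
    proof
      fix y assume "y \<in> closure (range G)"
      then obtain x where "V x y" using V_right by blast
      then show "y \<in> B ` closure (range g)"
        using B_eqI[OF V_W] V_closure(1) by blast
    qed
    show "cinner (B x) (B y) = cinner x y" if y: "y \<in> closure (range g)" for x y
    proof -
      obtain p where p: "x - p \<in> orth N" "V p (B x)" using WB unfolding W_def by blast
      obtain b where b: "V y b" using V_left[OF y] by blast
      have "cinner (B x) (B y) = cinner p y"
        using V_cinner[OF p(2) b] B_eqI[OF V_W[OF b]] by simp
      moreover have "cinner (x - p) y = 0" using p(1) y by (simp add: orth_def N_def)
      ultimately show ?thesis by (simp add: cinner_diff_left)
    qed
  qed
qed

section \<open>Selfadjoint relations\<close>

lemma csubspace_adj_rel: "csubspace (adj_rel T)"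
  unfolding csubspace_def adj_rel_def
  by (fastforce simp: cinner_simps zero_prod_def scaleC_prod_def)

lemma closed_adj_rel: "closed (adj_rel (T::('a::complex_inner \<times> 'a) set))"
proof -
  have "adj_rel T = (\<Inter>t\<in>T. {x. cinner (snd t) (fst x) = cinner (fst t) (snd x)})"
    unfolding adj_rel_def by fastforce
  moreover have "closed {x. cinner (snd t) (fst x) = cinner (fst t) (snd x)}" for t :: "'a \<times> 'a"
    by (intro closed_Collect_eq continuous_on_cinner continuous_intros)
  ultimately show ?thesis by auto
qed

lemma csubspace_pairD:
  assumes "csubspace S" "(x, x') \<in> S"
  shows "(y, y') \<in> S \<Longrightarrow> (x + y, x' + y') \<in> S"
    and "(y, y') \<in> S \<Longrightarrow> (x - y, x' - y') \<in> S"
    and "(c *\<^sub>C x, c *\<^sub>C x') \<in> S"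
proof -
  show "(x + y, x' + y') \<in> S" if "(y, y') \<in> S"
    using assms that unfolding csubspace_def by (metis add_Pair)
  show "(x - y, x' - y') \<in> S" if "(y, y') \<in> S"
    using csubspace_diff[OF assms that] by simp
  show "(c *\<^sub>C x, c *\<^sub>C x') \<in> S"
    using assms unfolding csubspace_def by (metis scaleC_prod_def fst_conv snd_conv)
qed

lemma selfadjoint_relD:
  "selfadjoint_rel K \<Longrightarrow> (f, f') \<in> K \<Longrightarrow> (g, g') \<in> K \<Longrightarrow> cinner f' g = cinner f g'"
  unfolding selfadjoint_rel_def adj_rel_def by blast

lemma selfadjoint_rel_csubspace: "selfadjoint_rel K \<Longrightarrow> csubspace K"
  by (metis selfadjoint_rel_def csubspace_adj_rel)

lemma selfadjoint_rel_closed: "selfadjoint_rel K \<Longrightarrow> closed K"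
  by (metis selfadjoint_rel_def closed_adj_rel)

text \<open>The pairing of \<open>g'\<close> with \<open>g\<close> is real, so the imaginary part of
  the pairing of g' - z g with g is - Im z |g|^2; Cauchy-Schwarz does the rest.\<close>

lemma selfadjoint_rel_resolvent_bound:
  assumes K: "selfadjoint_rel K" and g: "(g, g') \<in> K"
  shows "\<bar>Im z\<bar> * norm g \<le> norm (g' - z *\<^sub>C g)"
proof (cases "g = 0")
  case False
  have "Im (cinner g' g) = 0"
    using selfadjoint_relD[OF K g g] cinner_commute[of g' g] by (simp add: complex_eq_iff)
  then have "Im (cinner (g' - z *\<^sub>C g) g) = - Im z * (norm g)\<^sup>2"
    by (simp add: cinner_simps cinner_self)
  then have "\<bar>Im z\<bar> * (norm g)\<^sup>2 \<le> cmod (cinner (g' - z *\<^sub>C g) g)"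
    using abs_Im_le_cmod[of "cinner (g' - z *\<^sub>C g) g"] by (simp add: abs_mult)
  also have "\<dots> \<le> norm (g' - z *\<^sub>C g) * norm g" by (rule cinner_cauchy_schwarz)
  finally show ?thesis using False by (simp add: power2_eq_square)
qed simp

lemma selfadjoint_rel_resolvent_unique:
  assumes K: "selfadjoint_rel K" and "Im z \<noteq> 0" "(g, g') \<in> K" "(k, k') \<in> K"
    and "g' - z *\<^sub>C g = k' - z *\<^sub>C k"
  shows "g = k" "g' = k'"
proof -
  have "(g - k, g' - k') \<in> K"
    using selfadjoint_rel_csubspace[OF K] assms csubspace_pairD(2) by blast
  from selfadjoint_rel_resolvent_bound[OF K this, of z] show "g = k"
    using assms(2,5) by (simp add: scaleC_diff_right algebra_simps mult_le_0_iff)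
  then show "g' = k'" using assms(5) by simp
qed

lemma selfadjoint_rel_no_eigenvector:
  assumes K: "selfadjoint_rel K" and "Im z \<noteq> 0" "(f, z *\<^sub>C f) \<in> K"
  shows "f = 0"
  using selfadjoint_rel_resolvent_bound[OF K assms(3), of z] assms(2) by (simp add: mult_le_0_iff)

text \<open>The range of K - z is dense, because a vector orthogonal to it is an eigenvector of K* =
  K at the conjugate of z. By the resolvent bound, preimages of a convergent sequence have Cauchy
  first components, and closedness of K puts the limit in the range.\<close>

lemma selfadjoint_rel_resolvent_exists:
  fixes K :: "('a::chilbert \<times> 'a) set"
  assumes K: "selfadjoint_rel K" and z: "Im z \<noteq> 0"
  shows "\<exists>g g'. (g, g') \<in> K \<and> g' - z *\<^sub>C g = y"
proof -
  define R where "R = (\<lambda>(g, g'). g' - z *\<^sub>C g) ` K"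
  note sub = selfadjoint_rel_csubspace[OF K]
  have RI: "g' - z *\<^sub>C g \<in> R" if "(g, g') \<in> K" for g g'
    using that unfolding R_def by force
  have subR: "csubspace R"
    unfolding csubspace_def
  proof (intro conjI ballI allI)
    have "(0, 0) \<in> K" using sub by (simp add: csubspace_def zero_prod_def)
    from RI[OF this] show "0 \<in> R" by simp
  next
    fix x y assume "x \<in> R" "y \<in> R"
    then obtain g g' k k' where gk: "(g, g') \<in> K" "x = g' - z *\<^sub>C g" "(k, k') \<in> K" "y = k' - z *\<^sub>C k"
      unfolding R_def by auto
    from RI[OF csubspace_pairD(1)[OF sub gk(1,3)]] show "x + y \<in> R"
      by (simp add: gk scaleC_add_right algebra_simps)
  next
    fix c x assume "x \<in> R"
    then obtain g g' where g: "(g, g') \<in> K" "x = g' - z *\<^sub>C g"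
      unfolding R_def by auto
    from RI[OF csubspace_pairD(3)[OF sub g(1)]] show "c *\<^sub>C x \<in> R"
      by (simp add: g scaleC_simps mult.commute)
  qed
  have "x = 0" if x: "x \<in> orth R" for x
  proof -
    have "cinner g' x = cinner g (cnj z *\<^sub>C x)" if g: "(g, g') \<in> K" for g g'
    proof -
      have "cinner x (g' - z *\<^sub>C g) = 0" using x RI[OF g] by (simp add: orth_def)
      then have "cinner (g' - z *\<^sub>C g) x = 0" by (simp only: cinner_eq_zero_commute[of "g' - z *\<^sub>C g"])
      then show ?thesis by (simp add: cinner_simps)
    qed
    then have "(x, cnj z *\<^sub>C x) \<in> adj_rel K" by (auto simp: adj_rel_def)
    then have "(x, cnj z *\<^sub>C x) \<in> K" using K by (simp add: selfadjoint_rel_def)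
    then show "x = 0" using selfadjoint_rel_no_eigenvector[OF K, of "cnj z"] z by simp
  qed
  then have "y \<in> closure R"
    using closure_eq_UNIV_if_orth_trivial[OF subR] by blast
  then obtain u where u: "\<And>n::nat. u n \<in> R" "u \<longlonglongrightarrow> y"
    unfolding closure_sequential by blast
  have "\<exists>p. p \<in> K \<and> u n = snd p - z *\<^sub>C fst p" for n
    using u(1)[of n] unfolding R_def by force
  then obtain p where p: "\<And>n. p n \<in> K" "\<And>n. u n = snd (p n) - z *\<^sub>C fst (p n)"
    by metis
  have "Cauchy (\<lambda>n. fst (p n))"
  proof (rule metric_CauchyI)
    fix e :: real assume "0 < e"
    then have "0 < \<bar>Im z\<bar> * e" using z by simp
    then obtain N where N: "\<And>m n. m \<ge> N \<Longrightarrow> n \<ge> N \<Longrightarrow> dist (u m) (u n) < \<bar>Im z\<bar> * e"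
      using LIMSEQ_imp_Cauchy[OF u(2)] by (meson metric_CauchyD)
    have "dist (fst (p m)) (fst (p n)) < e" if mn: "m \<ge> N" "n \<ge> N" for m n
    proof -
      have "(fst (p m) - fst (p n), snd (p m) - snd (p n)) \<in> K"
        using csubspace_pairD(2)[OF sub] p(1) by simp
      from selfadjoint_rel_resolvent_bound[OF K this, of z]
      have "\<bar>Im z\<bar> * dist (fst (p m)) (fst (p n)) \<le> dist (u m) (u n)"
        by (simp add: dist_norm p(2) scaleC_diff_right algebra_simps)
      also have "\<dots> < \<bar>Im z\<bar> * e" by (rule N[OF mn])
      finally show ?thesis using z by (simp add: mult_less_cancel_left)
    qed
    then show "\<exists>N. \<forall>m\<ge>N. \<forall>n\<ge>N. dist (fst (p m)) (fst (p n)) < e" by blast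
  qed
  then obtain g where g: "(\<lambda>n. fst (p n)) \<longlonglongrightarrow> g"
    using Cauchy_convergent_iff convergent_def by blast
  have "(\<lambda>n. u n + z *\<^sub>C fst (p n)) \<longlonglongrightarrow> y + z *\<^sub>C g"
    by (intro tendsto_add u(2) tendsto_scaleC g)
  then have "(\<lambda>n. snd (p n)) \<longlonglongrightarrow> y + z *\<^sub>C g" by (simp add: p(2))
  from tendsto_Pair[OF g this] have "p \<longlonglongrightarrow> (g, y + z *\<^sub>C g)" by simp
  then have "(g, y + z *\<^sub>C g) \<in> K"
    using closed_sequentially[OF selfadjoint_rel_closed[OF K]] p(1) by blast
  then show ?thesis by (intro exI[of _ g] exI[of _ "y + z *\<^sub>C g"]) simp
qed

section \<open>B-generalized boundary pairs\<close>

locale boundary_pair =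
  fixes A :: "('a::chilbert \<times> 'a) set"
    and \<Gamma> :: "(('a \<times> 'a) \<times> ('b::chilbert \<times> 'b)) set"
  assumes pair: "B_generalized_boundary_pair A \<Gamma>"
begin

abbreviation "A0 \<equiv> Gamma0_ker \<Gamma>"

lemma selfadjoint_A0: "selfadjoint_rel A0"
  using pair by (simp add: B_generalized_boundary_pair_def)

lemmas csubspace_A0 = selfadjoint_rel_csubspace[OF selfadjoint_A0]

lemma csubspace_\<Gamma>: "csubspace \<Gamma>"
  using pair by (simp add: B_generalized_boundary_pair_def)

lemma \<Gamma>_diff:
  assumes "((f, f'), (h, h')) \<in> \<Gamma>" "((g, g'), (k, k')) \<in> \<Gamma>"
  shows "((f - g, f' - g'), (h - k, h' - k')) \<in> \<Gamma>"
  using csubspace_diff[OF csubspace_\<Gamma> assms] by simp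

lemma \<Gamma>_add:
  assumes "((f, f'), (h, h')) \<in> \<Gamma>" "((g, g'), (k, k')) \<in> \<Gamma>"
  shows "((f + g, f' + g'), (h + k, h' + k')) \<in> \<Gamma>"
  using csubspace_pairD(1)[OF csubspace_\<Gamma> assms] by simp

lemma \<Gamma>_scaleC:
  assumes "((f, f'), (h, h')) \<in> \<Gamma>"
  shows "((c *\<^sub>C f, c *\<^sub>C f'), (c *\<^sub>C h, c *\<^sub>C h')) \<in> \<Gamma>"
  using csubspace_pairD(3)[OF csubspace_\<Gamma> assms] by (simp add: scaleC_prod_def)

lemma green:
  assumes "((f, f'), (h, h')) \<in> \<Gamma>" "((g, g'), (k, k')) \<in> \<Gamma>"
  shows "cinner f' g - cinner f g' = cinner h' k - cinner h k'"
  using pair assms unfolding B_generalized_boundary_pair_def green_identity_def by blast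

lemma \<Gamma>_Domain: "(fh, hh) \<in> \<Gamma> \<Longrightarrow> fh \<in> adj_rel A"
  using pair unfolding B_generalized_boundary_pair_def by blast

lemma A0_iff: "fh \<in> A0 \<longleftrightarrow> (\<exists>k'. (fh, (0, k')) \<in> \<Gamma>)"
  by (simp add: Gamma0_ker_def)

lemma A0_subset: "fh \<in> A0 \<Longrightarrow> fh \<in> adj_rel A"
  using A0_iff \<Gamma>_Domain by blast

lemma \<Gamma>0_surj: "\<exists>fh h'. (fh, (h, h')) \<in> \<Gamma>"
  using pair unfolding B_generalized_boundary_pair_def Gamma0_ran_def by blast

text \<open>The resolvent of \<open>A0\<close> at \<open>z\<close> supplies the component in
  \<open>A0\<close>. What remains is an eigenpair, and it carries the whole boundary value
  \<open>h\<close> because the \<open>A0\<close> component has first boundary value 0.\<close>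

lemma \<Gamma>_decompose:
  assumes z: "Im z \<noteq> 0" and f: "((f, f'), (h, h')) \<in> \<Gamma>"
  obtains n k' where "((f - n, f' - z *\<^sub>C n), (0, k')) \<in> \<Gamma>" "((n, z *\<^sub>C n), (h, h' - k')) \<in> \<Gamma>"
proof -
  obtain g g' where g: "(g, g') \<in> A0" "g' - z *\<^sub>C g = f' - z *\<^sub>C f"
    using selfadjoint_rel_resolvent_exists[OF selfadjoint_A0 z] by blast
  then obtain k' where k': "((g, g'), (0, k')) \<in> \<Gamma>" by (auto simp: A0_iff)
  define n where "n = f - g"
  have *: "f - n = g" "f' - z *\<^sub>C n = g'" "f' - g' = z *\<^sub>C n"
    using g(2) by (simp_all add: n_def scaleC_diff_right algebra_simps)
  show thesis
    using that[of n k'] k' \<Gamma>_diff[OF f k'] by (simp add: * n_def[symmetric])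
qed

text \<open>The same splitting on all of A*, where boundary values in \<Gamma> need not
  exist.\<close>

lemma adj_rel_decompose:
  assumes z: "Im z \<noteq> 0" and f: "(f, f') \<in> adj_rel A"
  obtains n where "(f - n, f' - z *\<^sub>C n) \<in> A0" "(n, z *\<^sub>C n) \<in> adj_rel A"
proof -
  obtain g g' where g: "(g, g') \<in> A0" "g' - z *\<^sub>C g = f' - z *\<^sub>C f"
    using selfadjoint_rel_resolvent_exists[OF selfadjoint_A0 z] by blast
  define n where "n = f - g"
  have *: "f - n = g" "f' - z *\<^sub>C n = g'" "f' - g' = z *\<^sub>C n"
    using g(2) by (simp_all add: n_def scaleC_diff_right algebra_simps)
  show thesis
    using that[of n] g csubspace_pairD(2)[OF csubspace_adj_rel f A0_subset[OF g(1)]]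
    by (simp add: * n_def[symmetric])
qed

lemma decompose_unique:
  assumes z: "Im z \<noteq> 0" and "(f - n, f' - z *\<^sub>C n) \<in> A0" "(f - m, f' - z *\<^sub>C m) \<in> A0"
  shows "n = m"
  using selfadjoint_rel_resolvent_unique(1)[OF selfadjoint_A0 assms]
  by (simp add: scaleC_diff_right algebra_simps)

text \<open>The difference of two such elements is an eigenpair in \<open>A0\<close>, hence zero.
  Green's identity against arbitrary elements of \<Gamma>, whose first boundary values fill the
  space, then forces the second values to agree.\<close>

lemma weyl_family_unique:
  assumes z: "Im z \<noteq> 0" and "((n, z *\<^sub>C n), (h, h')) \<in> \<Gamma>" "((m, z *\<^sub>C m), (h, k')) \<in> \<Gamma>"
  shows "n = m" "h' = k'"
proof -
  have d: "((n - m, z *\<^sub>C (n - m)), (0, h' - k')) \<in> \<Gamma>"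
    using \<Gamma>_diff[OF assms(2,3)] by (simp add: scaleC_diff_right)
  then have "(n - m, z *\<^sub>C (n - m)) \<in> A0" by (auto simp: A0_iff)
  then have nm: "n - m = 0" by (rule selfadjoint_rel_no_eigenvector[OF selfadjoint_A0 z])
  then show "n = m" by simp
  have "cinner (h' - k') k = 0" for k
  proof -
    obtain g g' l' where "((g, g'), (k, l')) \<in> \<Gamma>" using \<Gamma>0_surj[of k] by auto
    from green[OF d this] show ?thesis by (simp add: nm)
  qed
  then have "h' - k' = 0" by (metis cinner_eq_zero_iff)
  then show "h' = k'" by simp
qed

lemma weyl_family_exists:
  assumes z: "Im z \<noteq> 0"
  shows "\<exists>n h'. ((n, z *\<^sub>C n), (h, h')) \<in> \<Gamma>"
proof -
  obtain f f' h' where "((f, f'), (h, h')) \<in> \<Gamma>" using \<Gamma>0_surj[of h] by auto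
  then show ?thesis by (rule \<Gamma>_decompose[OF z]) blast
qed

section \<open>The gamma-field and the Weyl function\<close>

definition gam :: "complex \<Rightarrow> 'b \<Rightarrow> 'a" where
  "gam z h = (THE n. \<exists>h'. ((n, z *\<^sub>C n), (h, h')) \<in> \<Gamma>)"

abbreviation "M \<equiv> weyl_op \<Gamma>"

lemma gam_eqI:
  assumes "Im z \<noteq> 0" "((n, z *\<^sub>C n), (h, h')) \<in> \<Gamma>"
  shows "gam z h = n" "M z h = h'"
proof -
  show "gam z h = n"
    unfolding gam_def by (rule the_equality) (use assms weyl_family_unique(1) in blast)+
  show "M z h = h'"
    unfolding weyl_op_def weyl_family_def
    by (rule the_equality) (use assms weyl_family_unique(2) in blast)+
qed

lemma gam_M:
  assumes z: "Im z \<noteq> 0"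
  shows "((gam z h, z *\<^sub>C gam z h), (h, M z h)) \<in> \<Gamma>"
  using weyl_family_exists[OF z, of h] gam_eqI[OF z] by fastforce

lemma gam_M_linear:
  assumes z: "Im z \<noteq> 0"
  shows "clinear (gam z)" "clinear (M z)"
proof -
  have "((gam z h + gam z k, z *\<^sub>C (gam z h + gam z k)), (h + k, M z h + M z k)) \<in> \<Gamma>" for h k
    unfolding scaleC_add_right by (rule \<Gamma>_add[OF gam_M[OF z] gam_M[OF z]])
  note a = gam_eqI[OF z this]
  have "((c *\<^sub>C gam z h, z *\<^sub>C c *\<^sub>C gam z h), (c *\<^sub>C h, c *\<^sub>C M z h)) \<in> \<Gamma>" for c h
    using \<Gamma>_scaleC[OF gam_M[OF z], of c h] unfolding scaleC_scaleC mult.commute[of z] .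
  note b = gam_eqI[OF z this]
  show "clinear (gam z)" "clinear (M z)" unfolding clinear_def by (intro conjI allI a b)+
qed

text \<open>Green's identity for two eigenpairs. Taking \<open>w\<close> as the conjugate of
  \<open>z\<close> annihilates the left side and yields the adjoint of M(z); taking
  \<open>w = z\<close> yields the imaginary part.\<close>

lemma green_gam:
  assumes "Im z \<noteq> 0" "Im w \<noteq> 0"
  shows "(z - cnj w) * cinner (gam z h) (gam w k) = cinner (M z h) k - cinner h (M w k)"
  using green[OF gam_M[OF assms(1), of h] gam_M[OF assms(2), of k]]
  by (simp add: cinner_simps algebra_simps)

lemma M_adjoint:
  assumes "Im z \<noteq> 0"
  shows "cinner (M z h) k = cinner h (M (cnj z) k)"
  using green_gam[OF assms, of "cnj z" h k] assms by simp

lemma im_op_M: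
  assumes "Im z \<noteq> 0"
  shows "im_op (M z) h = (1 / (2 * \<i>)) *\<^sub>C (M z h - M (cnj z) h)"
  using cadjoint_eqI[OF M_adjoint[OF assms], of h] by (simp add: im_op_def)

lemma cinner_im_op_M:
  assumes z: "Im z \<noteq> 0"
  shows "cinner (im_op (M z) h) k = Im z * cinner (gam z h) (gam z k)"
proof -
  have "cinner (M (cnj z) h) k = cinner h (M z k)"
    using M_adjoint[of "cnj z" h k] z by simp
  then have "cinner (im_op (M z) h) k = (1 / (2 * \<i>)) * ((z - cnj z) * cinner (gam z h) (gam z k))"
    unfolding green_gam[OF z z] im_op_M[OF z] by (simp only: cinner_simps)
  also have "(z - cnj z) = 2 * \<i> * Im z" by (simp add: complex_eq_iff)
  finally show ?thesis by simp
qed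

text \<open>The right side does not mention \<open>z\<close>; this is the source of the independence
  of \<open>Hs_space\<close> from the spectral parameter.\<close>

lemma gam_eq_zero_iff:
  assumes z: "Im z \<noteq> 0"
  shows "gam z h = 0 \<longleftrightarrow> (\<exists>h'. ((0, 0), (h, h')) \<in> \<Gamma>)"
  using gam_eqI(1)[OF z, of 0 h] gam_M[OF z, of h] by (metis scaleC_zero_right)

lemma im_op_M_kernel:
  assumes z: "Im z \<noteq> 0"
  shows "im_op (M z) h = 0 \<longleftrightarrow> gam z h = 0"
proof
  assume "im_op (M z) h = 0"
  then have "Im z * cinner (gam z h) (gam z h) = 0"
    using cinner_im_op_M[OF z, of h h] by simp
  then show "gam z h = 0" using z by (simp add: cinner_eq_zero_iff)
next
  assume "gam z h = 0"
  then have "cinner (im_op (M z) h) (im_op (M z) h) = 0" by (simp add: cinner_im_op_M[OF z])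
  then show "im_op (M z) h = 0" by (simp only: cinner_eq_zero_iff)
qed

lemma im_op_M_symmetric:
  assumes z: "Im z \<noteq> 0"
  shows "cinner (im_op (M z) h) k = cinner h (im_op (M z) k)"
  using cinner_im_op_M[OF z, of h k] cinner_im_op_M[OF z, of k h]
    cinner_commute[of h "im_op (M z) k"] cinner_commute[of "gam z h" "gam z k"] by simp

lemma im_op_M_clinear:
  assumes z: "Im z \<noteq> 0"
  shows "clinear (im_op (M z))"
  unfolding clinear_def
  by (intro conjI allI; rule cinner_ext)
     (use gam_M_linear(1)[OF z] in \<open>simp_all add: cinner_simps cinner_im_op_M[OF z] clinear_def algebra_simps\<close>)

lemma Hs_space_eq:
  assumes z: "Im z \<noteq> 0"
  shows "Hs_space \<Gamma> z = orth {h. \<exists>h'. ((0, 0), (h, h')) \<in> \<Gamma>}"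
  unfolding Hs_space_def
    closure_range_eq_orth_kernel[OF im_op_M_clinear[OF z] im_op_M_symmetric[OF z]]
  by (simp only: im_op_M_kernel[OF z] gam_eq_zero_iff[OF z])

text \<open>The adjoint is the second boundary value of the resolvent of \<open>A0\<close> at the
  conjugate of \<open>z\<close>: Green's identity for an eigenpair and an element of
  \<open>A0\<close> loses one term. With \<open>hellinger_toeplitz\<close> its existence gives
  boundedness of the gamma-field.\<close>

lemma gam_adjoint_exists:
  assumes z: "Im z \<noteq> 0"
  shows "\<exists>gs. \<forall>h x. cinner (gam z h) x = cinner h (gs x)"
proof -
  have "\<exists>k'. \<forall>h. cinner (gam z h) x = cinner h k'" for x
  proof -
    obtain g g' where g: "(g, g') \<in> A0" "g' - cnj z *\<^sub>C g = x"
      using selfadjoint_rel_resolvent_exists[OF selfadjoint_A0, of "cnj z" x] z by auto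
    then obtain k' where k': "((g, g'), (0, k')) \<in> \<Gamma>" by (auto simp: A0_iff)
    have "cinner (gam z h) x = cinner h k'" for h
      using green[OF gam_M[OF z, of h] k'] by (simp add: g(2)[symmetric] cinner_simps algebra_simps)
    then show ?thesis by blast
  qed
  then show ?thesis by metis
qed

lemma bounded_gam:
  assumes z: "Im z \<noteq> 0"
  shows "bounded_clinear (gam z)"
proof -
  obtain gs where "\<And>h x. cinner (gam z h) x = cinner h (gs x)" using gam_adjoint_exists[OF z] by blast
  then show ?thesis by (rule hellinger_toeplitz[OF gam_M_linear(1)[OF z]])
qed

text \<open>Density of dom \<Gamma> in A* enters here. Approximants of an eigenpair in dom \<Gamma>
  are split along \<open>A0\<close>; the resolvent bound sends their \<open>A0\<close> components to
  zero, so their gamma-field components converge to the eigenvector. Conversely, the eigenspace is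
  closed and contains the range.\<close>

lemma eigenspace_eq_closure_range_gam:
  assumes z: "Im z \<noteq> 0"
  shows "(n, z *\<^sub>C n) \<in> adj_rel A \<longleftrightarrow> n \<in> closure (range (gam z))"
proof
  assume "(n, z *\<^sub>C n) \<in> adj_rel A"
  then have "(n, z *\<^sub>C n) \<in> closure (Domain \<Gamma>)"
    using pair unfolding B_generalized_boundary_pair_def by blast
  then obtain u where u: "\<And>j::nat. u j \<in> Domain \<Gamma>" "u \<longlonglongrightarrow> (n, z *\<^sub>C n)"
    unfolding closure_sequential by blast
  have "\<exists>h. (fst (u j) - gam z h, snd (u j) - z *\<^sub>C gam z h) \<in> A0" for j
  proof -
    obtain h h' where "((fst (u j), snd (u j)), (h, h')) \<in> \<Gamma>" using u(1)[of j] by auto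
    then obtain m k' where mk: "((fst (u j) - m, snd (u j) - z *\<^sub>C m), (0, k')) \<in> \<Gamma>"
        "((m, z *\<^sub>C m), (h, h' - k')) \<in> \<Gamma>"
      by (rule \<Gamma>_decompose[OF z])
    then have "m = gam z h" using gam_eqI(1)[OF z] by metis
    then show ?thesis using mk(1) by (auto simp: A0_iff)
  qed
  then obtain h where h: "\<And>j. (fst (u j) - gam z (h j), snd (u j) - z *\<^sub>C gam z (h j)) \<in> A0" by metis
  have "norm (fst (u j) - gam z (h j)) \<le> norm (snd (u j) - z *\<^sub>C fst (u j)) / \<bar>Im z\<bar>" for j
  proof -
    have "\<bar>Im z\<bar> * norm (fst (u j) - gam z (h j))
        \<le> norm (snd (u j) - z *\<^sub>C gam z (h j) - z *\<^sub>C (fst (u j) - gam z (h j)))"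
      by (rule selfadjoint_rel_resolvent_bound[OF selfadjoint_A0 h])
    then show ?thesis using z by (simp add: scaleC_diff_right field_simps)
  qed
  then have le: "\<forall>j. norm (fst (u j) - gam z (h j)) \<le> norm (snd (u j) - z *\<^sub>C fst (u j)) / \<bar>Im z\<bar>"
    by blast
  have "(\<lambda>j. snd (u j) - z *\<^sub>C fst (u j)) \<longlonglongrightarrow> z *\<^sub>C n - z *\<^sub>C n"
    using tendsto_fst[OF u(2)] tendsto_snd[OF u(2)] by (intro tendsto_diff tendsto_scaleC) simp_all
  then have "(\<lambda>j. norm (snd (u j) - z *\<^sub>C fst (u j)) / \<bar>Im z\<bar>) \<longlonglongrightarrow> 0"
    by (intro tendsto_divide_zero tendsto_norm_zero) simp
  then have "(\<lambda>j. fst (u j) - gam z (h j)) \<longlonglongrightarrow> 0"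
    by (rule Lim_null_comparison[OF always_eventually[OF le]])
  from tendsto_diff[OF tendsto_fst[OF u(2)] this] have "(\<lambda>j. gam z (h j)) \<longlonglongrightarrow> n" by simp
  then show "n \<in> closure (range (gam z))"
    unfolding closure_sequential by (intro exI[of _ "\<lambda>j. gam z (h j)"]) simp
next
  assume "n \<in> closure (range (gam z))"
  moreover have "closure (range (gam z)) \<subseteq> {n. (n, z *\<^sub>C n) \<in> adj_rel A}"
  proof (rule closure_minimal)
    show "range (gam z) \<subseteq> {n. (n, z *\<^sub>C n) \<in> adj_rel A}"
      using \<Gamma>_Domain[OF gam_M[OF z]] by auto
    have "{n. (n, z *\<^sub>C n) \<in> adj_rel A} = (\<lambda>n. (n, z *\<^sub>C n)) -` adj_rel A" by auto
    moreover have "closed ((\<lambda>n. (n, z *\<^sub>C n)) -` adj_rel A)"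
      by (intro closed_vimage closed_adj_rel continuous_on_Pair continuous_on_id
          linear_continuous_on bounded_linear_scaleC)
    ultimately show "closed {n. (n, z *\<^sub>C n) \<in> adj_rel A}" by simp
  qed
  ultimately show "(n, z *\<^sub>C n) \<in> adj_rel A" by blast
qed

section \<open>The ordinary boundary triple\<close>

text \<open>The \<open>\<i>\<close>-eigenvector component with respect to \<open>A\<^sup>* = A0 + {{n, \<i>n}}\<close>.\<close>

definition eig :: "'a \<times> 'a \<Rightarrow> 'a" where
  "eig fh = (THE n. (fst fh - n, snd fh - \<i> *\<^sub>C n) \<in> A0)"

lemma eig_eqI: "(f - n, f' - \<i> *\<^sub>C n) \<in> A0 \<Longrightarrow> eig (f, f') = n"
  unfolding eig_def by (rule the_equality) (auto intro: decompose_unique[of \<i>])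

lemma eig:
  assumes "(f, f') \<in> adj_rel A"
  shows "(f - eig (f, f'), f' - \<i> *\<^sub>C eig (f, f')) \<in> A0"
    and "eig (f, f') \<in> closure (range (gam \<i>))"
proof -
  obtain n where n: "(f - n, f' - \<i> *\<^sub>C n) \<in> A0" "(n, \<i> *\<^sub>C n) \<in> adj_rel A"
    using adj_rel_decompose[of \<i>, OF _ assms] by auto
  then show "(f - eig (f, f'), f' - \<i> *\<^sub>C eig (f, f')) \<in> A0"
    by (simp add: eig_eqI)
  show "eig (f, f') \<in> closure (range (gam \<i>))"
    using n eigenspace_eq_closure_range_gam[of \<i> n] by (simp add: eig_eqI)
qed

lemma eig_add:
  assumes "(f, f') \<in> adj_rel A" "(g, g') \<in> adj_rel A"
  shows "eig (f + g, f' + g') = eig (f, f') + eig (g, g')"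
proof (rule eig_eqI)
  show "(f + g - (eig (f, f') + eig (g, g')), f' + g' - \<i> *\<^sub>C (eig (f, f') + eig (g, g'))) \<in> A0"
    using csubspace_pairD(1)[OF csubspace_A0 eig(1)[OF assms(1)] eig(1)[OF assms(2)]]
    by (simp add: scaleC_add_right algebra_simps)
qed

lemma eig_scaleC:
  assumes "(f, f') \<in> adj_rel A"
  shows "eig (c *\<^sub>C f, c *\<^sub>C f') = c *\<^sub>C eig (f, f')"
proof (rule eig_eqI)
  show "(c *\<^sub>C f - c *\<^sub>C eig (f, f'), c *\<^sub>C f' - \<i> *\<^sub>C c *\<^sub>C eig (f, f')) \<in> A0"
    using csubspace_pairD(3)[OF csubspace_A0 eig(1)[OF assms], of c]
    by (simp add: scaleC_diff_right scaleC_scaleC mult.commute)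
qed

definition triple0 :: "('a \<Rightarrow> 'b) \<Rightarrow> 'a \<times> 'a \<Rightarrow> 'b" where
  "triple0 B fh = B (eig fh)"

text \<open>For \<open>(f, f')\<close> split into an element \<open>(g, g')\<close> of
  \<open>A0\<close> and the eigenpair of \<open>n\<close>, a linear \<open>B\<close> turns this into
  B (g' + \<i> g) + \<i> B n.\<close>

definition triple1 :: "('a \<Rightarrow> 'b) \<Rightarrow> 'a \<times> 'a \<Rightarrow> 'b" where
  "triple1 B fh = B (snd fh + \<i> *\<^sub>C fst fh) - \<i> *\<^sub>C B (eig fh)"

lemma triple_green:
  assumes B: "clinear B"
    and iso: "\<forall>x. \<forall>y\<in>closure (range (gam \<i>)). cinner (B x) (B y) = cinner x y"
    and f: "(f, f') \<in> adj_rel A" and k: "(k, k') \<in> adj_rel A"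
  shows "cinner f' k - cinner f k' =
    cinner (triple1 B (f, f')) (triple0 B (k, k')) - cinner (triple0 B (f, f')) (triple1 B (k, k'))"
proof -
  define n m where "n = eig (f, f')" and "m = eig (k, k')"
  define g g' u u' where "g = f - n" and "g' = f' - \<i> *\<^sub>C n" and "u = k - m" and "u' = k' - \<i> *\<^sub>C m"
  have sym: "cinner g' u = cinner g u'"
    using selfadjoint_relD[OF selfadjoint_A0 eig(1)[OF f] eig(1)[OF k]]
    by (simp add: g_def g'_def u_def u'_def n_def m_def)
  have decomp: "f = g + n" "f' = g' + \<i> *\<^sub>C n" "k = u + m" "k' = u' + \<i> *\<^sub>C m"
    by (simp_all add: g_def g'_def u_def u'_def)
  have isom: "cinner (B x) (B m) = cinner x m" for x
    using iso eig(2)[OF k] by (simp add: m_def)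
  have ison: "cinner (B n) (B x) = cinner n x" for x
  proof -
    have "cinner (B x) (B n) = cinner x n" using iso eig(2)[OF f] by (simp add: n_def)
    then show ?thesis by (metis cinner_commute)
  qed
  have "cinner (triple1 B (f, f')) (triple0 B (k, k')) - cinner (triple0 B (f, f')) (triple1 B (k, k'))
      = cinner (f' + \<i> *\<^sub>C f) m - \<i> * cinner n m - cinner n (k' + \<i> *\<^sub>C k) - \<i> * cinner n m"
    unfolding triple0_def triple1_def n_def[symmetric] m_def[symmetric] fst_conv snd_conv
    by (simp add: cinner_diff_left cinner_diff_right cinner_scaleC_left cinner_scaleC_right isom ison)
  also have "\<dots> = cinner f' k - cinner f k'"
    unfolding decomp by (simp add: cinner_simps sym algebra_simps)
  finally show ?thesis by simp
qed

theorem ordinary_boundary_triple_triple: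
  assumes B: "clinear B"
    and iso: "\<forall>x. \<forall>y\<in>closure (range (gam \<i>)). cinner (B x) (B y) = cinner x y"
    and K: "csubspace K" "range B \<subseteq> K" "K \<subseteq> B ` closure (range (gam \<i>))"
  shows "ordinary_boundary_triple A K (triple0 B) (triple1 B)"
proof -
  have add: "B (x + y) = B x + B y" and scale: "B (c *\<^sub>C x) = c *\<^sub>C B x" for x y c
    using B by (simp_all add: clinear_def)
  have inK: "triple0 B fh \<in> K" "triple1 B fh \<in> K" for fh
    using K(1,2) csubspace_diff[OF K(1)] unfolding triple0_def triple1_def csubspace_def by blast+
  have surj: "(x, y) \<in> (\<lambda>fh. (triple0 B fh, triple1 B fh)) ` adj_rel A" if x: "x \<in> K" and y: "y \<in> K" for x y
  proof -
    obtain n where n: "x = B n" "n \<in> closure (range (gam \<i>))" using K(3) x by blast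
    \<comment> \<open>The second boundary value will be B (g' + \<i> g) + \<i> x, so
      \<open>y\<close> is reached by solving g' + \<i> g = v in \<open>A0\<close> with the resolvent
      at - \<i>.\<close>
    have "y - \<i> *\<^sub>C x \<in> K" using K(1) x y csubspace_diff[OF K(1)] unfolding csubspace_def by blast
    then obtain v where v: "y - \<i> *\<^sub>C x = B v" using K(3) by blast
    obtain g g' where g: "(g, g') \<in> A0" "g' - (- \<i>) *\<^sub>C g = v"
      using selfadjoint_rel_resolvent_exists[OF selfadjoint_A0, of "- \<i>" v] by auto
    have "(n, \<i> *\<^sub>C n) \<in> adj_rel A" using n(2) eigenspace_eq_closure_range_gam[of \<i> n] by simp
    then have mem: "(g + n, g' + \<i> *\<^sub>C n) \<in> adj_rel A"
      by (rule csubspace_pairD(1)[OF csubspace_adj_rel A0_subset[OF g(1)]])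
    have e: "eig (g + n, g' + \<i> *\<^sub>C n) = n" using g(1) by (intro eig_eqI) simp
    have t0: "triple0 B (g + n, g' + \<i> *\<^sub>C n) = x" by (simp add: triple0_def e n(1))
    have "triple1 B (g + n, g' + \<i> *\<^sub>C n) = B (v + (2 * \<i>) *\<^sub>C n) - \<i> *\<^sub>C B n"
      using scaleC_add_left[of \<i> \<i> n]
      by (simp add: g(2)[symmetric] triple1_def e scaleC_add_right algebra_simps)
    also have "\<dots> = B v + \<i> *\<^sub>C x"
      using scaleC_add_left[of \<i> \<i> "B n"] by (simp add: add scale n(1))
    finally have "triple1 B (g + n, g' + \<i> *\<^sub>C n) = y" by (simp add: v[symmetric])
    with t0 mem show ?thesis by (metis (no_types, lifting) image_eqI)
  qed
  show ?thesis
    unfolding ordinary_boundary_triple_def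
  proof (intro conjI ballI allI impI)
    fix fh gh assume fg: "fh \<in> adj_rel A" "gh \<in> adj_rel A"
    obtain f f' g g' where [simp]: "fh = (f, f')" "gh = (g, g')" by fastforce
    show "triple0 B (fh + gh) = triple0 B fh + triple0 B gh"
      "triple1 B (fh + gh) = triple1 B fh + triple1 B gh"
      using fg by (simp_all add: triple0_def triple1_def eig_add add scale scaleC_add_right)
  next
    fix c fh assume f: "fh \<in> adj_rel A"
    obtain f f' where [simp]: "fh = (f, f')" by fastforce
    show "triple0 B (c *\<^sub>C fh) = c *\<^sub>C triple0 B fh" "triple1 B (c *\<^sub>C fh) = c *\<^sub>C triple1 B fh"
      using f by (simp_all add: triple0_def triple1_def scaleC_prod_def eig_scaleC add scale
          scaleC_diff_right scaleC_add_right scaleC_scaleC mult.commute)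
  next
    show "(\<lambda>fh. (triple0 B fh, triple1 B fh)) ` adj_rel A = K \<times> K"
      using inK surj by auto
  qed (use inK triple_green[OF B iso] in auto)
qed

text \<open>\<open>triple0\<close> is injective on z-eigenpairs: \<open>B\<close> is isometric on
  the closed range of the gamma-field at \<i>, so equal values mean equal \<i>-eigencomponents; the
  difference then lies in \<open>A0\<close>, which has no nonreal eigenvalue. Hence the definite
  description in \<open>weyl_function\<close> has a unique solution.\<close>

lemma weyl_function_triple:
  assumes B: "clinear B"
    and iso: "\<forall>x. \<forall>y\<in>closure (range (gam \<i>)). cinner (B x) (B y) = cinner x y"
    and z: "Im z \<noteq> 0" and f: "(f, z *\<^sub>C f) \<in> adj_rel A"
  shows "weyl_function A (triple0 B) (triple1 B) z (triple0 B (f, z *\<^sub>C f)) = triple1 B (f, z *\<^sub>C f)"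
proof -
  have uniq: "f' = f" if f': "(f', z *\<^sub>C f') \<in> adj_rel A"
    and eq: "triple0 B (f', z *\<^sub>C f') = triple0 B (f, z *\<^sub>C f)" for f'
  proof -
    define n where "n = eig (f, z *\<^sub>C f)"
    define m where "m = eig (f', z *\<^sub>C f')"
    have nm: "n \<in> closure (range (gam \<i>))" "m \<in> closure (range (gam \<i>))"
      using eig(2)[OF f] eig(2)[OF f'] by (simp_all add: n_def m_def)
    have "B m - B n = 0" using eq by (simp add: triple0_def n_def m_def)
    then have "B (m - n) = 0" by (simp add: clinear_diff[OF B])
    moreover have "m - n \<in> closure (range (gam \<i>))"
      using csubspace_diff[OF csubspace_closure[OF csubspace_range[OF gam_M_linear(1)[of \<i>]]] nm(2,1)] by simp
    ultimately have "cinner (m - n) (m - n) = 0" using iso by fastforce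
    then have "m = n" by (simp add: cinner_eq_zero_iff)
    then have "(f' - f, z *\<^sub>C (f' - f)) \<in> A0"
      using csubspace_pairD(2)[OF csubspace_A0 eig(1)[OF f'] eig(1)[OF f]]
      by (simp add: n_def[symmetric] m_def[symmetric] scaleC_diff_right)
    then have "f' - f = 0" by (rule selfadjoint_rel_no_eigenvector[OF selfadjoint_A0 z])
    then show ?thesis by simp
  qed
  show ?thesis
    unfolding weyl_function_def by (rule the_equality) (use f uniq in auto)
qed

text \<open>Splitting the \<i>-eigenpair of \<open>n\<close> at \<open>z\<close> moves it along
  \<open>A0\<close> to a z-eigenpair with the same \<i>-eigencomponent.\<close>

lemma triple0_eigenvector_exists:
  assumes z: "Im z \<noteq> 0" and n: "n \<in> closure (range (gam \<i>))"
  shows "\<exists>f. (f, z *\<^sub>C f) \<in> adj_rel A \<and> triple0 B (f, z *\<^sub>C f) = B n"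
proof -
  have "(n, \<i> *\<^sub>C n) \<in> adj_rel A" using n eigenspace_eq_closure_range_gam[of \<i> n] by simp
  then obtain f where f: "(n - f, \<i> *\<^sub>C n - z *\<^sub>C f) \<in> A0" "(f, z *\<^sub>C f) \<in> adj_rel A"
    by (rule adj_rel_decompose[OF z])
  have "(f - n, z *\<^sub>C f - \<i> *\<^sub>C n) \<in> A0"
    using csubspace_pairD(3)[OF csubspace_A0 f(1), of "-1"] by (simp add: scaleC_one)
  then have "eig (f, z *\<^sub>C f) = n" by (rule eig_eqI)
  then show ?thesis using f(2) by (auto simp: triple0_def)
qed

section \<open>The representation of \<Gamma>\<close>

definition real_part :: "'b \<Rightarrow> 'b" where
  "real_part h = (1 / 2) *\<^sub>C (M \<i> h + M (- \<i>) h)"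

text \<open>\<open>M (- \<i>)\<close> is the adjoint of \<open>M \<i>\<close>, so
  \<open>real_part\<close> is the real part of M(\<i>). Its symmetry also gives boundedness through
  \<open>hellinger_toeplitz\<close>.\<close>

lemma real_part_symmetric: "cinner (real_part h) k = cinner h (real_part k)"
  using M_adjoint[of \<i> h k] M_adjoint[of "- \<i>" h k] by (simp add: real_part_def cinner_simps)

lemma bounded_real_part: "bounded_clinear real_part"
proof (rule hellinger_toeplitz[OF _ real_part_symmetric])
  show "clinear real_part"
    using gam_M_linear(2)[of \<i>] gam_M_linear(2)[of "- \<i>"]
    by (simp add: clinear_def real_part_def scaleC_simps algebra_simps)
qed

lemma real_part_im_op: "real_part h + \<i> *\<^sub>C im_op (M \<i>) h = M \<i> h"
proof -
  have "\<i> *\<^sub>C im_op (M \<i>) h = (1 / 2) *\<^sub>C (M \<i> h - M (- \<i>) h)"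
    by (simp add: im_op_M scaleC_scaleC)
  then show ?thesis
    using scaleC_add_left[of "1/2" "1/2" "M \<i> h"]
    by (simp add: real_part_def scaleC_simps)
qed

text \<open>Split \<open>(f, f')\<close> at \<i>. The eigencomponent contributes M(\<i>) h, which is
  Re M(\<i>) h plus \<i> G G h; the \<open>A0\<close> component contributes its second boundary
  value \<open>k'\<close>, which \<open>G\<close> recovers from \<open>B v\<close>.\<close>

lemma boundary_value_formula:
  assumes G: "\<And>h k. cinner (G h) k = cinner h (G k)" "\<And>h. G (G h) = im_op (M \<i>) h" "clinear G"
    and Bgam: "\<And>h. B (gam \<i> h) = G h" and B: "clinear B"
    and iso: "\<forall>x. \<forall>y\<in>closure (range (gam \<i>)). cinner (B x) (B y) = cinner x y"
    and \<Gamma>: "((f, f'), (h, h')) \<in> \<Gamma>"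
  shows "G h = triple0 B (f, f')" "h' = real_part h + G (triple1 B (f, f'))"
proof -
  obtain n k' where nk: "((f - n, f' - \<i> *\<^sub>C n), (0, k')) \<in> \<Gamma>" "((n, \<i> *\<^sub>C n), (h, h' - k')) \<in> \<Gamma>"
    using \<Gamma>_decompose[of \<i>, OF _ \<Gamma>] by auto
  have n: "n = gam \<i> h" "h' - k' = M \<i> h" using gam_eqI[of \<i>, OF _ nk(2)] by simp_all
  have e: "eig (f, f') = n" using nk(1) by (intro eig_eqI) (auto simp: A0_iff)
  show "G h = triple0 B (f, f')" by (simp add: triple0_def e n(1) Bgam)
  define v where "v = (f' - \<i> *\<^sub>C n) + \<i> *\<^sub>C (f - n)"
  \<comment> \<open>G B acts as the adjoint of the gamma-field at \<i>: test against
    \<open>k\<close>, move \<open>G\<close> across, write \<open>G k\<close> as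
    \<open>B (gam \<i> k)\<close>, drop \<open>B\<close>, and apply Green's identity.\<close>
  have Gv: "G (B v) = k'"
  proof (rule cinner_ext)
    fix k
    have "gam \<i> k \<in> closure (range (gam \<i>))"
      using closure_subset[of "range (gam \<i>)"] by blast
    then have "cinner (B v) (B (gam \<i> k)) = cinner v (gam \<i> k)" using iso by blast
    then have "cinner (G (B v)) k = cinner v (gam \<i> k)" by (simp only: G(1) Bgam)
    also have "\<dots> = cinner k' k"
      using green[OF nk(1) gam_M[of \<i> k]] unfolding v_def by (simp add: cinner_add_left cinner_scaleC_left cinner_scaleC_right)
    finally show "cinner (G (B v)) k = cinner k' k" .
  qed
  have "f' + \<i> *\<^sub>C f = v + (\<i> *\<^sub>C n + \<i> *\<^sub>C n)"
    by (simp add: v_def scaleC_diff_right)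
  then have "triple1 B (f, f') = B v + \<i> *\<^sub>C G h"
    using B by (simp add: triple1_def e clinear_def scaleC_add_left Bgam[symmetric] n(1)[symmetric])
  then have "G (triple1 B (f, f')) = k' + \<i> *\<^sub>C im_op (M \<i>) h"
    using G(3) by (simp add: clinear_def Gv G(2))
  then have "real_part h + G (triple1 B (f, f')) = k' + M \<i> h"
    using real_part_im_op[of h] by (simp add: algebra_simps)
  then show "h' = real_part h + G (triple1 B (f, f'))"
    using n(2) by (simp add: algebra_simps)
qed

text \<open>Since \<open>B\<close> is injective on the closed range of the gamma-field at \<i>, the
  condition on \<open>h\<close> identifies the eigencomponent with \<open>gam \<i> h\<close>. Adding
  a lift of the \<open>A0\<close> component to that eigenpair gives an element of \<Gamma>.\<close>

lemma boundary_pair_membership: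
  assumes Bgam: "\<And>h. B (gam \<i> h) = G h" and B: "clinear B"
    and iso: "\<forall>x. \<forall>y\<in>closure (range (gam \<i>)). cinner (B x) (B y) = cinner x y"
    and f: "(f, f') \<in> adj_rel A" and h: "G h = triple0 B (f, f')"
  shows "\<exists>h'. ((f, f'), (h, h')) \<in> \<Gamma>"
proof -
  define n where "n = eig (f, f')"
  have "B (gam \<i> h - n) = 0"
    using h by (simp add: clinear_diff[OF B] Bgam triple0_def n_def)
  moreover have "gam \<i> h - n \<in> closure (range (gam \<i>))"
    using csubspace_diff[OF csubspace_closure[OF csubspace_range[OF gam_M_linear(1)[of \<i>]]], of "gam \<i> h" n]
      eig(2)[OF f] closure_subset[of "range (gam \<i>)"] by (auto simp: n_def)
  ultimately have "cinner (gam \<i> h - n) (gam \<i> h - n) = 0"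
    using iso by fastforce
  then have n: "gam \<i> h = n" by (simp add: cinner_eq_zero_iff)
  obtain k' where "((f - n, f' - \<i> *\<^sub>C n), (0, k')) \<in> \<Gamma>"
    using eig(1)[OF f] by (auto simp: A0_iff n_def)
  from \<Gamma>_add[OF this gam_M[of \<i> h]] show ?thesis unfolding n by auto
qed

theorem boundary_pair_representation:
  "\<exists>G00 G10 E G.
       ordinary_boundary_triple A (Hs_space \<Gamma> \<i>) G00 G10 \<and>
       bounded_clinear E \<and> cadjoint E = E \<and>
       bounded_clinear G \<and> range G \<subseteq> Hs_space \<Gamma> \<i> \<and>
       {h. G h = 0} = orth (Hs_space \<Gamma> \<i>) \<and>
       \<Gamma> = {(fh, (h, E h + cadjoint G (G10 fh))) | fh h. fh \<in> adj_rel A \<and> G h = G00 fh} \<and>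
       (\<forall>z. Im z \<noteq> 0 \<longrightarrow>
          weyl_family \<Gamma> z = {(h, cadjoint G (weyl_function A G00 G10 z (G h)) + E h) | h. True})"
proof -
  have gl: "clinear (gam \<i>)" by (simp add: gam_M_linear)
  obtain gs where gs: "\<And>h x. cinner (gam \<i> h) x = cinner h (gs x)"
    using gam_adjoint_exists[of \<i>] by auto
  obtain G where G: "bounded_clinear G" "\<And>h k. cinner (G h) k = cinner h (G k)"
    "\<And>h. G (G h) = gs (gam \<i> h)"
    using modulus_exists[OF bounded_gam[of \<i>] gs] by auto
  have Gl: "clinear G" using G(1) by (rule bounded_clinear_clinear)
  have GG: "G (G h) = im_op (M \<i>) h" for h
    by (rule cinner_ext_right) (simp add: G(3) gs[symmetric] im_op_M_symmetric[symmetric] cinner_im_op_M)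
  have "(norm (gam \<i> h))\<^sup>2 = (norm (G h))\<^sup>2" for h
    by (simp only: norm_sq_cinner gs G(2) G(3))
  then have eq: "norm (gam \<i> h) = norm (G h)" for h by simp
  have ker: "{h. G h = 0} = {h. \<exists>h'. ((0, 0), (h, h')) \<in> \<Gamma>}"
    using eq gam_eq_zero_iff[of \<i>] by (metis norm_eq_zero one_neq_zero imaginary_unit.simps(2))
  \<comment> \<open>\<open>G\<close> is symmetric, and its kernel is the one whose orthogonal
    complement is \<open>Hs_space\<close> by \<open>Hs_space_eq\<close>.\<close>
  have Hs: "Hs_space \<Gamma> \<i> = closure (range G)"
    unfolding closure_range_eq_orth_kernel[OF Gl G(2)] ker by (simp add: Hs_space_eq)
  obtain B where B: "clinear B" "\<And>h. B (gam \<i> h) = G h" "range B \<subseteq> closure (range G)"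
    "closure (range G) \<subseteq> B ` closure (range (gam \<i>))"
    "\<And>x y. y \<in> closure (range (gam \<i>)) \<Longrightarrow> cinner (B x) (B y) = cinner x y"
    using partial_isometry_exists[OF gl Gl eq] by metis
  then have iso: "\<forall>x. \<forall>y\<in>closure (range (gam \<i>)). cinner (B x) (B y) = cinner x y" by blast
  have adjG: "cadjoint G = G" by (intro ext cadjoint_eqI G(2))
  note boundary_values = boundary_value_formula[OF G(2) GG Gl B(2,1) iso]
  have rep: "((f, f'), (h, h')) \<in> \<Gamma> \<longleftrightarrow>
      (f, f') \<in> adj_rel A \<and> G h = triple0 B (f, f') \<and> h' = real_part h + G (triple1 B (f, f'))" for f f' h h'
  proof
    assume "((f, f'), (h, h')) \<in> \<Gamma>"
    then show "(f, f') \<in> adj_rel A \<and> G h = triple0 B (f, f') \<and> h' = real_part h + G (triple1 B (f, f'))"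
      by (intro conjI boundary_values \<Gamma>_Domain)
  next
    assume f: "(f, f') \<in> adj_rel A \<and> G h = triple0 B (f, f') \<and> h' = real_part h + G (triple1 B (f, f'))"
    then obtain k' where k': "((f, f'), (h, k')) \<in> \<Gamma>"
      using boundary_pair_membership[OF B(2,1) iso, of f f' h] by blast
    \<comment> \<open>Membership provides only some second value \<open>k'\<close>; the boundary
      value formula forces it to be the given \<open>h'\<close>.\<close>
    from boundary_values(2)[OF k'] f k' show "((f, f'), (h, h')) \<in> \<Gamma>" by simp
  qed
  have weyl: "weyl_family \<Gamma> z
      = {(h, G (weyl_function A (triple0 B) (triple1 B) z (G h)) + real_part h) | h. True}"
    if z: "Im z \<noteq> 0" for z
  proof -
    have "(h, h') \<in> weyl_family \<Gamma> z \<longleftrightarrow>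
        h' = G (weyl_function A (triple0 B) (triple1 B) z (G h)) + real_part h" for h h'
    proof -
      have "gam \<i> h \<in> closure (range (gam \<i>))"
        using closure_subset[of "range (gam \<i>)"] by blast
      then obtain f where f: "(f, z *\<^sub>C f) \<in> adj_rel A" "triple0 B (f, z *\<^sub>C f) = G h"
        using triple0_eigenvector_exists[OF z, of "gam \<i> h" B] B(2) by auto
      \<comment> \<open>Stated for every suitable eigenvector, so that the Weyl function can replace
        \<open>triple1\<close> under the existential quantifier below.\<close>
      have w: "weyl_function A (triple0 B) (triple1 B) z (G h) = triple1 B (f, z *\<^sub>C f)" if
        "(f, z *\<^sub>C f) \<in> adj_rel A" "triple0 B (f, z *\<^sub>C f) = G h" for f
        using weyl_function_triple[OF B(1) iso z that(1)] that(2) by simp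
      have "(h, h') \<in> weyl_family \<Gamma> z \<longleftrightarrow> (\<exists>f. (f, z *\<^sub>C f) \<in> adj_rel A \<and> triple0 B (f, z *\<^sub>C f) = G h \<and>
          h' = G (triple1 B (f, z *\<^sub>C f)) + real_part h)"
        unfolding weyl_family_def by (auto simp: rep add.commute)
      also have "\<dots> \<longleftrightarrow> (\<exists>f. (f, z *\<^sub>C f) \<in> adj_rel A \<and> triple0 B (f, z *\<^sub>C f) = G h \<and>
          h' = G (weyl_function A (triple0 B) (triple1 B) z (G h)) + real_part h)"
        using w by metis
      finally show ?thesis using f by blast
    qed
    then show ?thesis by auto
  qed
  show ?thesis
  proof (intro exI conjI allI impI)
    show "ordinary_boundary_triple A (Hs_space \<Gamma> \<i>) (triple0 B) (triple1 B)"
      unfolding Hs using B(1,3,4) iso csubspace_closure[OF csubspace_range[OF Gl]]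
      by (intro ordinary_boundary_triple_triple) auto
    show "bounded_clinear real_part" by (rule bounded_real_part)
    show "cadjoint real_part = real_part" by (intro ext cadjoint_eqI real_part_symmetric)
    show "bounded_clinear G" by (rule G(1))
    show "range G \<subseteq> Hs_space \<Gamma> \<i>" unfolding Hs by (rule closure_subset)
    show "{h. G h = 0} = orth (Hs_space \<Gamma> \<i>)"
      unfolding Hs using orth_closure_range[OF G(2)] by simp
    show "\<Gamma> = {(fh, (h, real_part h + cadjoint G (triple1 B fh))) | fh h. fh \<in> adj_rel A \<and> G h = triple0 B fh}"
      unfolding adjG using rep by (auto simp: set_eq_iff)
    show "weyl_family \<Gamma> z
      = {(h, cadjoint G (weyl_function A (triple0 B) (triple1 B) z (G h)) + real_part h) | h. True}"
      if "Im z \<noteq> 0" for z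
      unfolding adjG by (rule weyl[OF that])
  qed
qed

end

text \<open>The first conjunct makes the choice of \<i> in the second immaterial. Equality of the
  Weyl family with a graph also says that it is an everywhere defined operator.\<close>

theorem mainTheorem6:
  fixes A :: "('a::chilbert \<times> 'a) set"
    and \<Gamma> :: "(('a \<times> 'a) \<times> ('b::chilbert \<times> 'b)) set"
  assumes "closed_symmetric_rel A"
    and "B_generalized_boundary_pair A \<Gamma>"
  shows "(\<forall>z w. Im z \<noteq> 0 \<longrightarrow> Im w \<noteq> 0 \<longrightarrow> Hs_space \<Gamma> z = Hs_space \<Gamma> w) \<and>
    (\<exists>G00 G10 E G.
       ordinary_boundary_triple A (Hs_space \<Gamma> \<i>) G00 G10 \<and>
       bounded_clinear E \<and> cadjoint E = E \<and>
       bounded_clinear G \<and> range G \<subseteq> Hs_space \<Gamma> \<i> \<and>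
       {h. G h = 0} = orth (Hs_space \<Gamma> \<i>) \<and>
       \<Gamma> = {(fh, (h, E h + cadjoint G (G10 fh))) | fh h. fh \<in> adj_rel A \<and> G h = G00 fh} \<and>
       (\<forall>z. Im z \<noteq> 0 \<longrightarrow>
          weyl_family \<Gamma> z = {(h, cadjoint G (weyl_function A G00 G10 z (G h)) + E h) | h. True}))"
proof -
  interpret boundary_pair A \<Gamma> by unfold_locales (rule assms(2))
  show ?thesis
    by (intro conjI allI impI boundary_pair_representation) (simp add: Hs_space_eq)
qed

end
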